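(* Let $\Lambda>0$, $\boldsymbol\gamma=(\gamma_1,\dots,\gamma_d)$ with $\gamma_j>0$, $(P_1,\dots,P_d)\sim\text{Vec-FDP}(\Lambda,\boldsymbol\gamma,P_0)$, and let $A\subset\Theta$ be measurable with $0<P_0(A)<1$. For $j\neq l$ in $\{1,\dots,d\}$, $$\operatorname{corr}(P_j(A),P_l(A))=\frac{1-e^{-\Lambda}}{\Lambda\sqrt{(\gamma_j+1)(\gamma_l+1)\,I(\gamma_j,\Lambda)\,I(\gamma_l,\Lambda)}},$$ where $I(\gamma,\Lambda)=\int_0^1(1+\Lambda x)e^{-\Lambda(1-x)}\left(1-x^{1/\gamma}\right)\mathrm dx$. Moreover, for fixed $\Lambda$, $$\lim_{\gamma_j,\gamma_l\to0}\operatorname{corr}(P_j(A),P_l(A))=\frac{1-e^{-\Lambda}}{\Lambda},\qquad \lim_{\gamma_j,\gamma_l\to\infty}\operatorname{corr}(P_j(A),P_l(A))=1.$$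
   Context: Vec-FDP. Let $P_0$ be a diffuse (non-atomic) probability measure on $\Theta\subset\mathbb R^s$. Let $M-1\sim\text{Poisson}(\Lambda)$ (i.e. $M$ is 1-shifted Poisson). Conditionally on $M$, let $\tau_1,\dots,\tau_M$ be i.i.d. from $P_0$ and, independently, let $S_{j,m}\sim\text{Gamma}(\gamma_j,1)$ (shape-rate) be independent for $1\le j\le d$, $1\le m\le M$. The law of $(P_1,\dots,P_d)$ with $P_j=\sum_{m=1}^M\frac{S_{j,m}}{\sum_{r=1}^MS_{j,r}}\delta_{\tau_m}$ is denoted $\text{Vec-FDP}(\Lambda,\boldsymbol\gamma,P_0)$. $\operatorname{corr}$ denotes Pearson correlation. *)

theory Defs
  imports "HOL-Probability.Probability"
begin

definition covariance :: "'a measure \<Rightarrow> ('a \<Rightarrow> real) \<Rightarrow> ('a \<Rightarrow> real) \<Rightarrow> real" where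
  "covariance M X Y =
    (\<integral>x. (X x - (\<integral>y. X y \<partial>M)) * (Y x - (\<integral>y. Y y \<partial>M)) \<partial>M)"

definition corr :: "'a measure \<Rightarrow> ('a \<Rightarrow> real) \<Rightarrow> ('a \<Rightarrow> real) \<Rightarrow> real" where
  "corr M X Y = covariance M X Y / sqrt (covariance M X X * covariance M Y Y)"

text \<open>The sample space of the Gamma law is taken to be the open half-line (and not the whole
  real line), so that the normalised weights below are positive and sum to 1 at every sample
  point rather than only almost surely.\<close>

definition gamma_distribution :: "real \<Rightarrow> real \<Rightarrow> real measure" where
  "gamma_distribution shape rate =
    density (restrict_space lborel {0<..})
      (\<lambda>x. ennreal (rate powr shape / Gamma shape * x powr (shape - 1) * exp (- rate * x)))"

definition discrete_measure :: "'a measure \<Rightarrow> nat \<Rightarrow> (nat \<Rightarrow> real) \<Rightarrow> (nat \<Rightarrow> 'a) \<Rightarrow> 'a measure" where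
  "discrete_measure N n w \<tau> =
    measure_of (space N) (sets N) (\<lambda>B. \<Sum>m=1..n. ennreal (w m) * emeasure (return N (\<tau> m)) B)"

definition normalized_measures ::
    "nat \<Rightarrow> 'a measure \<Rightarrow> nat \<Rightarrow> (nat \<Rightarrow> 'a) \<times> (nat \<times> nat \<Rightarrow> real) \<Rightarrow> nat \<Rightarrow> 'a measure" where
  "normalized_measures d P\<^sub>0 n = (\<lambda>(\<tau>, S). \<lambda>j\<in>{1..d}.
     discrete_measure P\<^sub>0 n (\<lambda>m. S (j, m) / (\<Sum>r=1..n. S (j, r))) \<tau>)"

text \<open>The space of \<open>d\<close>-tuples, indexed by \<open>{1..d}\<close>, of probability measures on the space of
  \<open>P\<^sub>0\<close>, with the product of the usual sigma-algebras generated by the evaluation maps.\<close>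

definition prob_tuples :: "nat \<Rightarrow> 'a measure \<Rightarrow> (nat \<Rightarrow> 'a measure) measure" where
  "prob_tuples d P\<^sub>0 = PiM {1..d} (\<lambda>_. prob_algebra P\<^sub>0)"

definition atoms_and_weights ::
    "nat \<Rightarrow> (nat \<Rightarrow> real) \<Rightarrow> 'a measure \<Rightarrow> nat \<Rightarrow> ((nat \<Rightarrow> 'a) \<times> (nat \<times> nat \<Rightarrow> real)) measure" where
  "atoms_and_weights d \<gamma> P\<^sub>0 n =
     PiM {1..n} (\<lambda>_. P\<^sub>0) \<Otimes>\<^sub>M PiM ({1..d} \<times> {1..n}) (\<lambda>(j, m). gamma_distribution (\<gamma> j) 1)"

definition vec_fdp_given ::
    "nat \<Rightarrow> (nat \<Rightarrow> real) \<Rightarrow> 'a measure \<Rightarrow> nat \<Rightarrow> (nat \<Rightarrow> 'a measure) measure" where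
  "vec_fdp_given d \<gamma> P\<^sub>0 n =
     distr (atoms_and_weights d \<gamma> P\<^sub>0 n) (prob_tuples d P\<^sub>0) (normalized_measures d P\<^sub>0 n)"

text \<open>Here \<open>k\<close> is Poisson and the number of atoms is \<open>k + 1\<close>; \<open>vec_fdp_given d \<gamma> P\<^sub>0 n\<close> is the
  conditional law given that there are \<open>n\<close> atoms.\<close>

definition vec_fdp ::
    "nat \<Rightarrow> real \<Rightarrow> (nat \<Rightarrow> real) \<Rightarrow> 'a measure \<Rightarrow> (nat \<Rightarrow> 'a measure) measure" where
  "vec_fdp d \<Lambda> \<gamma> P\<^sub>0 =
     measure_pmf (poisson_pmf \<Lambda>) \<bind> (\<lambda>k. vec_fdp_given d \<gamma> P\<^sub>0 (Suc k))"

definition fdp_I :: "real \<Rightarrow> real \<Rightarrow> real" where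
  "fdp_I \<gamma> \<Lambda> =
    (LBINT x:{0..1}. (1 + \<Lambda> * x) * exp (- \<Lambda> * (1 - x)) * (1 - x powr (1 / \<gamma>)))"

lemma prob_space_gamma_distribution:
  assumes "a > 0"
  shows "prob_space (gamma_distribution a 1)"
proof
  have "emeasure (gamma_distribution a 1) (space (gamma_distribution a 1)) =
      (\<integral>\<^sup>+x. ennreal (1 / Gamma a * x powr (a - 1) * exp (- x)) \<partial>restrict_space lborel {0<..})"
    unfolding gamma_distribution_def
    by (subst emeasure_density)
       (auto intro!: nn_integral_cong measurable_restrict_space1 simp: space_restrict_space sets_restrict_space)
  also have "\<dots> = (\<integral>\<^sup>+x. ennreal (1 / Gamma a * x powr (a - 1) * exp (- x)) * indicator {0<..} x \<partial>lborel)"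
    by (subst nn_integral_restrict_space) auto
  also have "\<dots> = (\<integral>\<^sup>+x. ennreal (1 / Gamma a) * ennreal (indicator {0..} x * x powr (a - 1) / exp x) \<partial>lborel)"
    using Gamma_real_pos[OF assms]
    by (intro nn_integral_cong)
       (auto simp: indicator_def exp_minus field_simps simp flip: ennreal_mult')
  also have "\<dots> = ennreal (1 / Gamma a) * (\<integral>\<^sup>+x. ennreal (indicator {0..} x * x powr (a - 1) / exp x) \<partial>lborel)"
    by (rule nn_integral_cmult) measurable
  also have "\<dots> = ennreal (1 / Gamma a) * ennreal (Gamma a)"
    using Gamma_conv_nn_integral_real[OF assms] by simp
  also have "\<dots> = 1"
    using Gamma_real_pos[OF assms] by (simp flip: ennreal_mult')
  finally show "emeasure (gamma_distribution a 1) (space (gamma_distribution a 1)) = 1" .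
qed

lemma space_gamma_distribution [simp]: "space (gamma_distribution a b) = {0<..}"
  by (simp add: gamma_distribution_def space_restrict_space)

lemma sets_discrete_measure [simp, measurable_cong]: "sets (discrete_measure N n w \<tau>) = sets N"
  by (simp add: discrete_measure_def)

lemma space_discrete_measure [simp]: "space (discrete_measure N n w \<tau>) = space N"
  by (simp add: discrete_measure_def)

lemma emeasure_discrete_measure:
  assumes "B \<in> sets N"
  shows "emeasure (discrete_measure N n w \<tau>) B =
    (\<Sum>m=1..n. ennreal (w m) * indicator B (\<tau> m))"
proof -
  have "emeasure (discrete_measure N n w \<tau>) B =
      (\<Sum>m=1..n. ennreal (w m) * emeasure (return N (\<tau> m)) B)"
    unfolding discrete_measure_def
  proof (rule emeasure_measure_of_sigma)
    show "sigma_algebra (space N) (sets N)" ..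
    show "positive (sets N) (\<lambda>B. \<Sum>m=1..n. ennreal (w m) * emeasure (return N (\<tau> m)) B)"
      by (simp add: positive_def)
    show "countably_additive (sets N) (\<lambda>B. \<Sum>m=1..n. ennreal (w m) * emeasure (return N (\<tau> m)) B)"
    proof (rule countably_additiveI)
      fix F :: "nat \<Rightarrow> 'a set"
      assume F: "range F \<subseteq> sets N" "disjoint_family F"
      have "(\<Sum>i. \<Sum>m=1..n. ennreal (w m) * emeasure (return N (\<tau> m)) (F i)) =
          (\<Sum>m=1..n. \<Sum>i. ennreal (w m) * emeasure (return N (\<tau> m)) (F i))"
        by (rule suminf_sum) auto
      also have "\<dots> = (\<Sum>m=1..n. ennreal (w m) * emeasure (return N (\<tau> m)) (\<Union>i. F i))"
        using F by (intro sum.cong refl, subst ennreal_suminf_cmult, subst suminf_emeasure) auto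
      finally show "(\<Sum>i. \<Sum>m=1..n. ennreal (w m) * emeasure (return N (\<tau> m)) (F i)) =
          (\<Sum>m=1..n. ennreal (w m) * emeasure (return N (\<tau> m)) (\<Union>i. F i))" .
    qed
  qed fact
  with assms show ?thesis
    by simp
qed

lemma measurable_normalized_measures:
  assumes "n \<ge> 1"
  shows "normalized_measures d P\<^sub>0 n \<in> atoms_and_weights d \<gamma> P\<^sub>0 n \<rightarrow>\<^sub>M prob_tuples d P\<^sub>0"
proof -
  let ?M = "atoms_and_weights d \<gamma> P\<^sub>0 n"
  let ?w = "\<lambda>j m S. S (j, m) / (\<Sum>r=1..n. S (j, r))"
  have prob: "prob_space (discrete_measure P\<^sub>0 n (\<lambda>m. ?w j m (snd x)) (fst x))"
    if j: "j \<in> {1..d}" and x: "x \<in> space ?M" for j x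
  proof -
    have \<tau>: "fst x m \<in> space P\<^sub>0" if "m \<in> {1..n}" for m
      using x that by (auto simp: atoms_and_weights_def space_pair_measure space_PiM)
    have S: "snd x (j, m) > 0" if "m \<in> {1..n}" for m
      using x that j by (auto simp: atoms_and_weights_def space_pair_measure space_PiM PiE_iff)
    have pos: "(\<Sum>r=1..n. snd x (j, r)) > 0"
      using S assms by (intro sum_pos) auto
    show ?thesis
    proof
      have "emeasure (discrete_measure P\<^sub>0 n (\<lambda>m. ?w j m (snd x)) (fst x)) (space P\<^sub>0) =
          (\<Sum>m=1..n. ennreal (?w j m (snd x)))"
        using \<tau> by (subst emeasure_discrete_measure) (auto intro!: sum.cong)
      also have "\<dots> = ennreal (\<Sum>m=1..n. ?w j m (snd x))"
        using S pos by (intro sum_ennreal) (auto intro!: divide_nonneg_pos less_imp_le)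
      also have "(\<Sum>m=1..n. ?w j m (snd x)) = 1"
        using pos by (simp flip: sum_divide_distrib)
      finally show "emeasure (discrete_measure P\<^sub>0 n (\<lambda>m. ?w j m (snd x)) (fst x))
          (space (discrete_measure P\<^sub>0 n (\<lambda>m. ?w j m (snd x)) (fst x))) = 1"
        by simp
    qed
  qed
  have comp: "(\<lambda>x. discrete_measure P\<^sub>0 n (\<lambda>m. ?w j m (snd x)) (fst x)) \<in> ?M \<rightarrow>\<^sub>M prob_algebra P\<^sub>0"
    if j: "j \<in> {1..d}" for j
  proof (rule measurable_prob_algebraI)
    have [measurable]: "(\<lambda>x. fst x m) \<in> ?M \<rightarrow>\<^sub>M P\<^sub>0" if "m \<in> {1..n}" for m
      unfolding atoms_and_weights_def using that by measurable
    have "(\<lambda>x. snd x (j, m)) \<in> ?M \<rightarrow>\<^sub>M gamma_distribution (\<gamma> j) 1" if "m \<in> {1..n}" for m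
      unfolding atoms_and_weights_def
      using measurable_component_singleton[of "(j, m)" "{1..d} \<times> {1..n}" "\<lambda>(j, m). gamma_distribution (\<gamma> j) 1"]
        that j by (intro measurable_compose[OF measurable_snd]) auto
    moreover have "(\<lambda>x. x) \<in> gamma_distribution (\<gamma> j) 1 \<rightarrow>\<^sub>M borel"
      by (auto simp: gamma_distribution_def intro!: measurable_restrict_space1)
    ultimately have [measurable]: "(\<lambda>x. snd x (j, m)) \<in> borel_measurable ?M" if "m \<in> {1..n}" for m
      using that measurable_compose by blast
    show "(\<lambda>x. discrete_measure P\<^sub>0 n (\<lambda>m. ?w j m (snd x)) (fst x)) \<in> ?M \<rightarrow>\<^sub>M subprob_algebra P\<^sub>0"
    proof (rule measurable_subprob_algebra)
      show "subprob_space (discrete_measure P\<^sub>0 n (\<lambda>m. ?w j m (snd x)) (fst x))"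
        if "x \<in> space ?M" for x
        using prob[OF j that] by (rule prob_space_imp_subprob_space)
      show "(\<lambda>x. emeasure (discrete_measure P\<^sub>0 n (\<lambda>m. ?w j m (snd x)) (fst x)) B) \<in> borel_measurable ?M"
        if [measurable]: "B \<in> sets P\<^sub>0" for B
        unfolding emeasure_discrete_measure[OF that] by measurable
    qed simp
  qed (rule prob[OF j])
  show ?thesis
    unfolding prob_tuples_def normalized_measures_def case_prod_beta'
    by (rule measurable_restrict) (rule comp)
qed

lemma prob_space_atoms_and_weights:
  assumes "prob_space P\<^sub>0" "\<And>j. j \<in> {1..d} \<Longrightarrow> \<gamma> j > 0"
  shows "prob_space (atoms_and_weights d \<gamma> P\<^sub>0 n)"
  unfolding atoms_and_weights_def
  using assms by (intro prob_space_pair prob_space_PiM) (auto intro: prob_space_gamma_distribution)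

lemma vec_fdp_given_in_prob_algebra:
  assumes "prob_space P\<^sub>0" "\<And>j. j \<in> {1..d} \<Longrightarrow> \<gamma> j > 0" "n \<ge> 1"
  shows "vec_fdp_given d \<gamma> P\<^sub>0 n \<in> space (prob_algebra (prob_tuples d P\<^sub>0))"
  unfolding vec_fdp_given_def space_prob_algebra
  using prob_space.prob_space_distr[OF prob_space_atoms_and_weights measurable_normalized_measures]
    assms by auto

lemma vec_fdp_in_prob_algebra:
  assumes "prob_space P\<^sub>0" "\<And>j. j \<in> {1..d} \<Longrightarrow> \<gamma> j > 0"
  shows "vec_fdp d \<Lambda> \<gamma> P\<^sub>0 \<in> space (prob_algebra (prob_tuples d P\<^sub>0))"
proof -
  have kernel: "(\<lambda>k. vec_fdp_given d \<gamma> P\<^sub>0 (Suc k)) \<in>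
      measure_pmf (poisson_pmf \<Lambda>) \<rightarrow>\<^sub>M prob_algebra (prob_tuples d P\<^sub>0)"
    using vec_fdp_given_in_prob_algebra[OF assms] by (auto simp: measurable_def)
  have pmf: "measure_pmf (poisson_pmf \<Lambda>) \<in> space (prob_algebra (measure_pmf (poisson_pmf \<Lambda>)))"
    by (simp add: space_prob_algebra measure_pmf.prob_space_axioms)
  show ?thesis
    unfolding vec_fdp_def
    using prob_space_bind'[OF pmf kernel] sets_bind'[OF pmf kernel]
    by (simp add: space_prob_algebra)
qed

end

(* Given M = n, centring gives P_j(A) - P0(A) = sum_m W_{j,m} (1_A(tau_m) - P0(A)) with W_j the
   normalised Gamma weights, so the atoms contribute a factor p(1-p) on the diagonal only and
   Cov(P_j(A), P_l(A) | n) = p(1-p) sum_m E[W_{j,m} W_{l,m}].  This is p(1-p)/n for j distinct from l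
   and p(1-p)(gamma_j+1)/(n gamma_j+1) for j = l; the moments of W_{j,m} come from
   1/T^(k+1) = int_0^oo t^k/k! exp(-tT) dt, which factorises the Gamma expectation.
   The conditional mean is constant, so the covariances are Poisson averages of these.
   Averaging 1/(gamma M + 1) = int_0^1 M x^(M-1) (1 - x^(1/gamma)) dx against the generating
   function x exp(-Lambda(1-x)) of M yields I(gamma, Lambda).  For the limits, (gamma+1) E[1/(gamma M+1)]
   is squeezed between elementary bounds. *)

theory Submission
  imports Defs
begin

section \<open>Moments of normalised Gamma variables\<close>

text \<open>Every covariance carries the same factor p(1-p), so the correlation is E[1/M] divided by
  the geometric mean of v(gamma_j) and v(gamma_l), where v(gamma) = E[(gamma+1)/(gamma M+1)]. Both
  limits thereby become one-variable questions about v: the ratio inside tends to 1 as gamma -> 0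
  and to 1/M as gamma -> infinity, which leaves E[1/M] in the first case and E[1/M]/E[1/M] in the
  second. The obstacle in the Gamma moments is the random denominator: a sum over a whole row ties
  all its coordinates together, whereas the exponential of such a sum splits into one factor per
  coordinate. This is the purpose of the auxiliary variable t. Both there and in the series for I,
  integrals are exchanged in the nonnegative extended setting, where nothing has to be integrable
  beforehand, and real values are recovered at the end. Given M, rows are independent as far as
  weights go, so the dependence between P_j and P_l comes from the shared atoms.\<close>

lemma nn_integral_gamma_distribution:
  assumes a: "a > 0" and f[measurable]: "f \<in> borel_measurable borel"
  shows "(\<integral>\<^sup>+x. f x \<partial>gamma_distribution a 1) =
    (\<integral>\<^sup>+x. ennreal (x powr (a - 1) * exp (- x) / Gamma a) * f x * indicator {0<..} x \<partial>lborel)"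
proof -
  have "(\<integral>\<^sup>+x. f x \<partial>gamma_distribution a 1) =
      (\<integral>\<^sup>+x. ennreal (1 / Gamma a * x powr (a - 1) * exp (- x)) * f x \<partial>restrict_space lborel {0<..})"
    unfolding gamma_distribution_def
    by (subst nn_integral_density)
       (auto intro!: measurable_restrict_space1)
  also have "\<dots> = (\<integral>\<^sup>+x. ennreal (1 / Gamma a * x powr (a - 1) * exp (- x)) * f x * indicator {0<..} x \<partial>lborel)"
    by (subst nn_integral_restrict_space) auto
  finally show ?thesis by (simp add: mult.commute)
qed

text \<open>The factor exp(-t x) is absorbed by rescaling: substituting (1+t)x in Euler's integral
  for Gamma(a+k) produces the power of 1+t, and Gamma(a+k)/Gamma(a) is the rising factorial.\<close>

lemma gamma_distribution_exp_moment:
  assumes a: "a > 0" and t: "t \<ge> 0"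
  shows "(\<integral>\<^sup>+x. ennreal (x ^ k * exp (- t * x)) \<partial>gamma_distribution a 1) =
    ennreal (pochhammer a k * (1 + t) powr - (a + k))"
proof -
  have Ga: "Gamma a > 0" using a by (rule Gamma_real_pos)
  have poch: "pochhammer a k = Gamma (a + k) / Gamma a"
    using a by (intro pochhammer_Gamma) (auto elim!: nonpos_Ints_cases)
  have "ennreal (Gamma (a + k)) =
      (\<integral>\<^sup>+x. ennreal (indicator {0..} x * x powr (a + k - 1) / exp x) \<partial>lborel)"
    using a by (intro Gamma_conv_nn_integral_real) auto
  also have "\<dots> = ennreal (1 + t) * (\<integral>\<^sup>+x. ennreal (indicator {0..} ((1 + t) * x) * ((1 + t) * x) powr (a + k - 1) / exp ((1 + t) * x)) \<partial>lborel)"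
    using t by (subst nn_integral_real_affine[where c = "1 + t" and t = 0]) auto
  also have "(\<integral>\<^sup>+x. ennreal (indicator {0..} ((1 + t) * x) * ((1 + t) * x) powr (a + k - 1) / exp ((1 + t) * x)) \<partial>lborel)
    = (\<integral>\<^sup>+x. ennreal (Gamma a * (1 + t) powr (a + k - 1)) *
       (ennreal (x powr (a - 1) * exp (- x) / Gamma a) * ennreal (x ^ k * exp (- t * x)) * indicator {0<..} x) \<partial>lborel)"
  proof (intro nn_integral_cong_AE, use AE_lborel_singleton[of "0::real"] in eventually_elim)
    \<comment> \<open>The null point 0 lies in \<open>{0..}\<close> but not in
      \<open>{0<..}\<close>; discarding it leaves two strict sign cases.\<close>
    fix x :: real assume "x \<noteq> 0"
    show "ennreal (indicator {0..} ((1 + t) * x) * ((1 + t) * x) powr (a + k - 1) / exp ((1 + t) * x)) =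
       ennreal (Gamma a * (1 + t) powr (a + k - 1)) *
       (ennreal (x powr (a - 1) * exp (- x) / Gamma a) * ennreal (x ^ k * exp (- t * x)) * indicator {0<..} x)"
    proof (cases "x > 0")
      case True
      have "x powr (a + k - 1) = x powr (a - 1) * x ^ k"
        using True by (simp add: powr_realpow[symmetric] powr_add[symmetric] algebra_simps)
      moreover have exp_eq: "exp ((1 + t) * x) = exp x * exp (t * x)"
        by (simp add: distrib_right exp_add)
      ultimately have "((1 + t) * x) powr (a + k - 1) / exp ((1 + t) * x) =
          Gamma a * (1 + t) powr (a + k - 1) * (x powr (a - 1) * exp (- x) / Gamma a * (x ^ k * exp (- t * x)))"
        using True t Ga by (simp add: powr_mult exp_minus exp_eq divide_inverse mult_ac)
      then show ?thesis
        using True t Ga by (simp add: ennreal_mult[symmetric])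
    next
      case False
      with \<open>x \<noteq> 0\<close> t have "(1 + t) * x < 0"
        by (intro mult_pos_neg) auto
      with False show ?thesis
        by simp
    qed
  qed
  also have "\<dots> = ennreal (Gamma a * (1 + t) powr (a + k - 1)) * (\<integral>\<^sup>+x. ennreal (x ^ k * exp (- t * x)) \<partial>gamma_distribution a 1)"
    by (subst nn_integral_cmult, measurable, subst nn_integral_gamma_distribution[OF a]) auto
  finally have eq: "ennreal (Gamma (a + k)) = ennreal (Gamma a * (1 + t) powr (a + k)) *
      (\<integral>\<^sup>+x. ennreal (x ^ k * exp (- t * x)) \<partial>gamma_distribution a 1)"
    (is "_ = _ * ?I")
    using t Ga
    by (subst (asm) mult.assoc[symmetric], subst (asm) ennreal_mult[symmetric])
       (simp_all add: powr_diff)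
  \<comment> \<open>The equation is solved for \<open>?I\<close> by multiplying with an explicit
    finite inverse, so finiteness of \<open>?I\<close> comes out as a result instead of being needed
    first.\<close>
  have "?I = (ennreal (1 / (Gamma a * (1 + t) powr (a + k))) * ennreal (Gamma a * (1 + t) powr (a + k))) * ?I"
    using Ga t by (subst ennreal_mult'[symmetric]) auto
  also have "\<dots> = ennreal (1 / (Gamma a * (1 + t) powr (a + k))) * ennreal (Gamma (a + k))"
    unfolding eq by (simp add: mult.assoc)
  also have "\<dots> = ennreal (pochhammer a k * (1 + t) powr - (a + k))"
    unfolding poch using Ga t
    by (subst ennreal_mult'[symmetric]) (simp_all only: powr_minus_divide, simp_all add: mult_ac)
  finally show ?thesis .
qed

text \<open>Up to the factor 1/T^(k+1) the integrand is the Erlang density of rate \<open>T\<close>,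
  whose total mass is its zeroth moment 1.\<close>

lemma nn_integral_power_exp:
  assumes "T > (0::real)"
  shows "(\<integral>\<^sup>+t. ennreal (t ^ k / fact k * exp (- t * T)) * indicator {0..} t \<partial>lborel) = ennreal (1 / T ^ Suc k)"
proof -
  have "(\<integral>\<^sup>+t. ennreal (t ^ k / fact k * exp (- t * T)) * indicator {0..} t \<partial>lborel) =
      (\<integral>\<^sup>+t. ennreal (1 / T ^ Suc k) * ennreal (erlang_density k T t) \<partial>lborel)"
    using assms by (intro nn_integral_cong)
      (auto simp: erlang_density_def indicator_def field_simps simp flip: ennreal_mult')
  also have "\<dots> = ennreal (1 / T ^ Suc k) * (\<integral>\<^sup>+t. ennreal (erlang_density k T t) \<partial>lborel)"
    by (rule nn_integral_cmult) auto
  also have "(\<integral>\<^sup>+t. ennreal (erlang_density k T t) \<partial>lborel) = 1"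
    using nn_integral_erlang_ith_moment[OF assms, of k 0] by simp
  finally show ?thesis by simp
qed

text \<open>Tonelli moves the denominator into an exponent: for fixed t the inner expectation is of
  Laplace type, and when \<open>T\<close> is a sum of independent coordinates it factorises.\<close>

lemma (in sigma_finite_measure) nn_integral_power_ratio:
  fixes X T :: "'a \<Rightarrow> real"
  assumes [measurable]: "X \<in> borel_measurable M" "T \<in> borel_measurable M"
    and T: "\<And>x. x \<in> space M \<Longrightarrow> T x > 0"
  shows "(\<integral>\<^sup>+x. ennreal ((X x / T x) ^ Suc k) \<partial>M) =
    (\<integral>\<^sup>+t. ennreal (t ^ k / fact k) * (\<integral>\<^sup>+x. ennreal (X x ^ Suc k * exp (- t * T x)) \<partial>M) * indicator {0..} t \<partial>lborel)"
proof -
  interpret pair_sigma_finite lborel M ..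
  have "(\<integral>\<^sup>+x. ennreal ((X x / T x) ^ Suc k) \<partial>M) =
    (\<integral>\<^sup>+x. (\<integral>\<^sup>+t. ennreal (X x ^ Suc k) * (ennreal (t ^ k / fact k * exp (- t * T x)) * indicator {0..} t) \<partial>lborel) \<partial>M)"
  proof (intro nn_integral_cong)
    fix x assume "x \<in> space M"
    then have Tx: "T x > 0" by (rule T)
    have "ennreal ((X x / T x) ^ Suc k) = ennreal (X x ^ Suc k * (1 / T x ^ Suc k))"
      by (simp only: power_divide times_divide_eq_right mult_1_right)
    also have "\<dots> = ennreal (X x ^ Suc k) * ennreal (1 / T x ^ Suc k)"
      using Tx by (intro ennreal_mult'') auto
    also have "\<dots> = ennreal (X x ^ Suc k) * (\<integral>\<^sup>+t. ennreal (t ^ k / fact k * exp (- t * T x)) * indicator {0..} t \<partial>lborel)"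
      by (simp only: nn_integral_power_exp[OF Tx])
    also have "\<dots> = (\<integral>\<^sup>+t. ennreal (X x ^ Suc k) * (ennreal (t ^ k / fact k * exp (- t * T x)) * indicator {0..} t) \<partial>lborel)"
      by (rule nn_integral_cmult[symmetric]) measurable
    finally show "ennreal ((X x / T x) ^ Suc k) =
      (\<integral>\<^sup>+t. ennreal (X x ^ Suc k) * (ennreal (t ^ k / fact k * exp (- t * T x)) * indicator {0..} t) \<partial>lborel)" .
  qed
  also have "\<dots> = (\<integral>\<^sup>+t. (\<integral>\<^sup>+x. ennreal (X x ^ Suc k) * (ennreal (t ^ k / fact k * exp (- t * T x)) * indicator {0..} t) \<partial>M) \<partial>lborel)"
    by (rule Fubini') measurable
  also have "\<dots> = (\<integral>\<^sup>+t. ennreal (t ^ k / fact k) * (\<integral>\<^sup>+x. ennreal (X x ^ Suc k * exp (- t * T x)) \<partial>M) * indicator {0..} t \<partial>lborel)"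
  proof (intro nn_integral_cong)
    fix t :: real
    have "(\<integral>\<^sup>+x. ennreal (X x ^ Suc k) * (ennreal (t ^ k / fact k * exp (- t * T x)) * indicator {0..} t) \<partial>M) =
       (\<integral>\<^sup>+x. ennreal (t ^ k / fact k) * indicator {0..} t * ennreal (X x ^ Suc k * exp (- t * T x)) \<partial>M)"
      by (intro nn_integral_cong) (simp only: ennreal_mult''[OF exp_ge_zero], simp add: mult_ac)
    also have "\<dots> = ennreal (t ^ k / fact k) * indicator {0..} t * (\<integral>\<^sup>+x. ennreal (X x ^ Suc k * exp (- t * T x)) \<partial>M)"
      by (rule nn_integral_cmult) measurable
    finally show "(\<integral>\<^sup>+x. ennreal (X x ^ Suc k) * (ennreal (t ^ k / fact k * exp (- t * T x)) * indicator {0..} t) \<partial>M) =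
       ennreal (t ^ k / fact k) * (\<integral>\<^sup>+x. ennreal (X x ^ Suc k * exp (- t * T x)) \<partial>M) * indicator {0..} t"
      by (simp only: mult_ac)
  qed
  finally show ?thesis .
qed

section \<open>Normalised coordinates under a product of Gamma laws\<close>

abbreviation gamma_product :: "'i set \<Rightarrow> ('i \<Rightarrow> real) \<Rightarrow> ('i \<Rightarrow> real) measure" where
  "gamma_product I a \<equiv> PiM I (\<lambda>i. gamma_distribution (a i) 1)"

lemma borel_measurable_gamma_distribution: "f \<in> borel_measurable borel \<Longrightarrow> f \<in> borel_measurable (gamma_distribution a b)"
  unfolding gamma_distribution_def by (auto intro: measurable_restrict_space1)

lemma measurable_gamma_product_component:
  "i \<in> I \<Longrightarrow> (\<lambda>S. S i) \<in> borel_measurable (gamma_product I a)"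
  by (rule measurable_compose[OF measurable_component_singleton]) (auto intro: borel_measurable_gamma_distribution)

text \<open>\<open>I\<close> is meant to be the whole table of Gamma variables and \<open>K\<close>
  one row of it. By independence the integrand splits: coordinate \<open>m\<close> gives a moment of
  order \<open>k\<close>, the other points of \<open>K\<close> give moments of order 0, and each
  coordinate outside \<open>K\<close> gives total mass 1.\<close>

lemma gamma_product_exp_moment:
  fixes a :: "'i \<Rightarrow> real"
  assumes fin: "finite I" and pos: "\<And>i. a i > 0" and KI: "K \<subseteq> I" and m: "m \<in> K" and t: "t \<ge> 0"
  shows "(\<integral>\<^sup>+S. ennreal (S m ^ k * exp (- t * (\<Sum>i\<in>K. S i))) \<partial>gamma_product I a) =
    ennreal (pochhammer (a m) k * (1 + t) powr - ((\<Sum>i\<in>K. a i) + k))"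
proof -
  interpret product_prob_space "\<lambda>i. gamma_distribution (a i) 1"
    by (intro product_prob_spaceI prob_space_gamma_distribution pos)
  have finK: "finite K" using fin KI by (rule rev_finite_subset)
  let ?f = "\<lambda>i x. ennreal ((if i = m then x ^ k else 1) * (if i \<in> K then exp (- t * x) else 1))"
  have "(\<integral>\<^sup>+S. ennreal (S m ^ k * exp (- t * (\<Sum>i\<in>K. S i))) \<partial>gamma_product I a) =
      (\<integral>\<^sup>+S. (\<Prod>i\<in>I. ?f i (S i)) \<partial>gamma_product I a)"
  proof (intro nn_integral_cong)
    fix S assume "S \<in> space (gamma_product I a)"
    then have S: "S i > 0" if "i \<in> I" for i
      using that by (auto simp: space_PiM)
    have "(\<Prod>i\<in>I. ?f i (S i)) =
        ennreal (\<Prod>i\<in>I. (if i = m then S i ^ k else 1) * (if i \<in> K then exp (- t * S i) else 1))"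
      using S by (subst prod_ennreal) (auto intro!: mult_nonneg_nonneg less_imp_le)
    also have "(\<Prod>i\<in>I. (if i = m then S i ^ k else 1) * (if i \<in> K then exp (- t * S i) else 1))
        = S m ^ k * (\<Prod>i\<in>K. exp (- t * S i))"
      using fin KI m by (simp add: prod.distrib prod.delta prod.inter_restrict[symmetric] Int_absorb1 subset_iff)
    also have "(\<Prod>i\<in>K. exp (- t * S i)) = exp (- t * (\<Sum>i\<in>K. S i))"
      by (simp add: exp_sum[OF finK, symmetric] sum_distrib_left sum_negf)
    finally show "ennreal (S m ^ k * exp (- t * (\<Sum>i\<in>K. S i))) = (\<Prod>i\<in>I. ?f i (S i))" ..
  qed
  also have "\<dots> = (\<Prod>i\<in>I. \<integral>\<^sup>+x. ?f i x \<partial>gamma_distribution (a i) 1)"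
    by (intro product_nn_integral_prod[OF fin] borel_measurable_gamma_distribution) measurable
  also have "\<dots> = (\<Prod>i\<in>I. ennreal ((if i = m then pochhammer (a m) k * (1 + t) powr - real k else 1) *
      (if i \<in> K then (1 + t) powr - a i else 1)))"
  proof (rule prod.cong[OF refl])
    fix i assume "i \<in> I"
    show "(\<integral>\<^sup>+x. ?f i x \<partial>gamma_distribution (a i) 1) =
      ennreal ((if i = m then pochhammer (a m) k * (1 + t) powr - real k else 1) * (if i \<in> K then (1 + t) powr - a i else 1))"
      using gamma_distribution_exp_moment[OF pos[of i] t, of k] gamma_distribution_exp_moment[OF pos[of i] t, of 0] m
        prob_space.emeasure_space_1[OF prob_space_gamma_distribution[OF pos[of i]]]
      by (auto simp: powr_add[symmetric] add.commute mult.assoc)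
  qed
  also have "\<dots> = ennreal (\<Prod>i\<in>I. (if i = m then pochhammer (a m) k * (1 + t) powr - real k else 1) *
      (if i \<in> K then (1 + t) powr - a i else 1))"
    using pos[of m] by (intro prod_ennreal) (auto intro!: mult_nonneg_nonneg pochhammer_nonneg)
  also have "(\<Prod>i\<in>I. (if i = m then pochhammer (a m) k * (1 + t) powr - real k else 1) *
      (if i \<in> K then (1 + t) powr - a i else 1)) = pochhammer (a m) k * (1 + t) powr - real k * (\<Prod>i\<in>K. (1 + t) powr - a i)"
    using fin KI m by (simp add: prod.distrib prod.delta prod.inter_restrict[symmetric] Int_absorb1 subset_iff)
  also have "(\<Prod>i\<in>K. (1 + t) powr - a i) = (1 + t) powr - (\<Sum>i\<in>K. a i)"
    using t by (simp add: powr_sum[symmetric] sum_negf)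
  finally show ?thesis
    by (simp only: mult.assoc powr_add[symmetric] minus_add_distrib add.commute)
qed

lemma gamma_product_normalized_moment_as_integral:
  fixes a :: "'i \<Rightarrow> real"
  assumes fin: "finite I" and pos: "\<And>i. a i > 0" and KI: "K \<subseteq> I" and m: "m \<in> K"
  shows "(\<integral>\<^sup>+S. ennreal ((S m / (\<Sum>i\<in>K. S i)) ^ Suc k) \<partial>gamma_product I a) =
    ennreal (pochhammer (a m) (Suc k)) *
    (\<integral>\<^sup>+t. ennreal (t ^ k / fact k * (1 + t) powr - ((\<Sum>i\<in>K. a i) + Suc k)) * indicator {0..} t \<partial>lborel)"
proof -
  interpret G: prob_space "gamma_product I a"
    by (intro prob_space_PiM prob_space_gamma_distribution pos)
  have "(\<integral>\<^sup>+S. ennreal ((S m / (\<Sum>i\<in>K. S i)) ^ Suc k) \<partial>gamma_product I a) =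
    (\<integral>\<^sup>+t. ennreal (t ^ k / fact k) * (\<integral>\<^sup>+S. ennreal (S m ^ Suc k * exp (- t * (\<Sum>i\<in>K. S i))) \<partial>gamma_product I a) * indicator {0..} t \<partial>lborel)"
  proof (rule G.nn_integral_power_ratio)
    show "(\<lambda>S. S m) \<in> borel_measurable (gamma_product I a)"
      using KI m by (blast intro: measurable_gamma_product_component)
    show "(\<lambda>S. \<Sum>i\<in>K. S i) \<in> borel_measurable (gamma_product I a)"
      using KI by (intro borel_measurable_sum measurable_gamma_product_component) blast
    fix S assume "S \<in> space (gamma_product I a)"
    then have S: "S i > 0" if "i \<in> I" for i
      using that by (auto simp: space_PiM)
    then show "(\<Sum>i\<in>K. S i) > 0"
      using KI m finite_subset[OF KI fin] by (intro sum_pos) auto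
  qed
  also have "\<dots> = (\<integral>\<^sup>+t. ennreal (pochhammer (a m) (Suc k)) * (ennreal (t ^ k / fact k * (1 + t) powr - ((\<Sum>i\<in>K. a i) + Suc k)) * indicator {0..} t) \<partial>lborel)"
  proof (intro nn_integral_cong)
    fix t :: real
    show "ennreal (t ^ k / fact k) * (\<integral>\<^sup>+S. ennreal (S m ^ Suc k * exp (- t * (\<Sum>i\<in>K. S i))) \<partial>gamma_product I a) * indicator {0..} t
      = ennreal (pochhammer (a m) (Suc k)) * (ennreal (t ^ k / fact k * (1 + t) powr - ((\<Sum>i\<in>K. a i) + Suc k)) * indicator {0..} t)"
    proof (cases "t \<ge> 0")
      case True
      have "ennreal (t ^ k / fact k) * (\<integral>\<^sup>+S. ennreal (S m ^ Suc k * exp (- t * (\<Sum>i\<in>K. S i))) \<partial>gamma_product I a) =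
        ennreal (t ^ k / fact k) * (ennreal (pochhammer (a m) (Suc k)) * ennreal ((1 + t) powr - ((\<Sum>i\<in>K. a i) + Suc k)))"
        by (simp only: gamma_product_exp_moment[OF fin pos KI m True] ennreal_mult''[OF powr_ge_zero])
      also have "\<dots> = ennreal (pochhammer (a m) (Suc k)) * (ennreal (t ^ k / fact k) * ennreal ((1 + t) powr - ((\<Sum>i\<in>K. a i) + Suc k)))"
        by (rule mult.left_commute)
      also have "\<dots> = ennreal (pochhammer (a m) (Suc k)) * ennreal (t ^ k / fact k * (1 + t) powr - ((\<Sum>i\<in>K. a i) + Suc k))"
        by (simp only: ennreal_mult''[OF powr_ge_zero])
      finally show ?thesis
        using True by (simp only: indicator_simps atLeast_iff mult_1_right)
    qed simp
  qed
  also have "\<dots> = ennreal (pochhammer (a m) (Suc k)) *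
    (\<integral>\<^sup>+t. ennreal (t ^ k / fact k * (1 + t) powr - ((\<Sum>i\<in>K. a i) + Suc k)) * indicator {0..} t \<partial>lborel)"
    by (rule nn_integral_cmult) measurable
  finally show ?thesis .
qed

text \<open>The remaining integral over \<open>t\<close> depends only on \<open>\<Sum>i\<in>K. a i\<close>; it is evaluated by
  applying the same identity to a single coordinate, where the normalised variable is 1.\<close>

lemma gamma_product_normalized_moment:
  fixes a :: "'i \<Rightarrow> real"
  assumes fin: "finite I" and pos: "\<And>i. a i > 0" and KI: "K \<subseteq> I" and m: "m \<in> K"
  shows "(\<integral>\<^sup>+S. ennreal ((S m / (\<Sum>i\<in>K. S i)) ^ Suc k) \<partial>gamma_product I a) =
    ennreal (pochhammer (a m) (Suc k) / pochhammer (\<Sum>i\<in>K. a i) (Suc k))"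
proof -
  define \<alpha> where "\<alpha> = (\<Sum>i\<in>K. a i)"
  have \<alpha>: "\<alpha> > 0"
    unfolding \<alpha>_def using KI m pos finite_subset[OF KI fin] by (intro sum_pos) auto
  define J where "J = (\<integral>\<^sup>+t. ennreal (t ^ k / fact k * (1 + t) powr - (\<alpha> + Suc k)) * indicator {0..} t \<partial>lborel)"
  interpret G: prob_space "gamma_product {()} (\<lambda>_. \<alpha>)"
    by (intro prob_space_PiM prob_space_gamma_distribution \<alpha>)
  \<comment> \<open>The sample space \<open>{0<..}\<close> excludes 0, so S/S is 1 at every point
    and not merely almost everywhere.\<close>
  have "1 = (\<integral>\<^sup>+S. ennreal ((S () / (\<Sum>i\<in>{()}. S i)) ^ Suc k) \<partial>gamma_product {()} (\<lambda>_. \<alpha>))"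
    by (subst nn_integral_cong[where v = "\<lambda>_. 1"])
       (use G.emeasure_space_1 in \<open>auto simp: space_PiM dest!: PiE_mem[where x = "()"]\<close>)
  also have "\<dots> = ennreal (pochhammer \<alpha> (Suc k)) * J"
    using gamma_product_normalized_moment_as_integral[where I = "{()}" and a = "\<lambda>_. \<alpha>" and K = "{()}" and m = "()" and k = k] \<alpha>
    by (simp only: J_def sum.insert sum.empty finite.intros subset_refl insertI1 add_0_right finite.emptyI empty_iff not_False_eq_True)
  finally have J: "ennreal (pochhammer \<alpha> (Suc k)) * J = 1" ..
  have p: "pochhammer \<alpha> (Suc k) > 0"
    using \<alpha> by (rule pochhammer_pos)
  have "J = ennreal (1 / pochhammer \<alpha> (Suc k)) * (ennreal (pochhammer \<alpha> (Suc k)) * J)"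
    using p by (subst mult.assoc[symmetric], subst ennreal_mult''[symmetric]) simp_all
  also have "\<dots> = ennreal (1 / pochhammer \<alpha> (Suc k))"
    unfolding J by simp
  finally have "J = ennreal (1 / pochhammer \<alpha> (Suc k))" .
  then have "(\<integral>\<^sup>+S. ennreal ((S m / (\<Sum>i\<in>K. S i)) ^ Suc k) \<partial>gamma_product I a) =
      ennreal (pochhammer (a m) (Suc k)) * ennreal (1 / pochhammer \<alpha> (Suc k))"
    using gamma_product_normalized_moment_as_integral[OF fin pos KI m, where k = k]
    by (simp only: \<alpha>_def[symmetric] J_def[symmetric])
  also have "\<dots> = ennreal (pochhammer (a m) (Suc k) * (1 / pochhammer \<alpha> (Suc k)))"
    using p by (intro ennreal_mult''[symmetric]) simp
  finally show ?thesis
    by (simp add: \<alpha>_def)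
qed

lemma gamma_product_normalized_expectation:
  fixes a :: "'i \<Rightarrow> real"
  assumes fin: "finite I" and pos: "\<And>i. a i > 0" and KI: "K \<subseteq> I" and m: "m \<in> K"
  shows "(\<integral>S. (S m / (\<Sum>i\<in>K. S i)) ^ Suc k \<partial>gamma_product I a) =
    pochhammer (a m) (Suc k) / pochhammer (\<Sum>i\<in>K. a i) (Suc k)"
proof -
  have "(\<integral>S. (S m / (\<Sum>i\<in>K. S i)) ^ Suc k \<partial>gamma_product I a) =
      enn2real (\<integral>\<^sup>+S. ennreal ((S m / (\<Sum>i\<in>K. S i)) ^ Suc k) \<partial>gamma_product I a)"
  proof (rule integral_eq_nn_integral)
    show "(\<lambda>S. (S m / (\<Sum>i\<in>K. S i)) ^ Suc k) \<in> borel_measurable (gamma_product I a)"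
      using KI m by (intro borel_measurable_power borel_measurable_divide borel_measurable_sum
          measurable_gamma_product_component) auto
    show "AE S in gamma_product I a. 0 \<le> (S m / (\<Sum>i\<in>K. S i)) ^ Suc k"
    proof (intro AE_I2 zero_le_power divide_nonneg_nonneg sum_nonneg)
      fix S i assume "S \<in> space (gamma_product I a)" "i \<in> K"
      then show "S i \<ge> 0"
        using KI by (auto simp: space_PiM PiE_iff intro!: less_imp_le)
    next
      fix S assume "S \<in> space (gamma_product I a)"
      then show "S m \<ge> 0"
        using KI m by (auto simp: space_PiM PiE_iff intro!: less_imp_le)
    qed
  qed
  also have "\<dots> = pochhammer (a m) (Suc k) / pochhammer (\<Sum>i\<in>K. a i) (Suc k)"
  proof -
    have "(\<Sum>i\<in>K. a i) > 0"
      using KI m pos finite_subset[OF KI fin] by (intro sum_pos) auto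
    then show ?thesis
      using pos[of m]
      by (simp only: gamma_product_normalized_moment[OF fin pos KI m])
         (intro enn2real_ennreal divide_nonneg_nonneg pochhammer_nonneg; simp)
  qed
  finally show ?thesis .
qed

text \<open>Coordinates are independent under a product measure, hence so are blocks of coordinates
  over disjoint index sets. The blocks will be two different rows of Gamma variables.\<close>

lemma integral_PiM_mult_disjoint:
  fixes f g :: "('i \<Rightarrow> 'a) \<Rightarrow> real"
  assumes prob: "\<And>i. i \<in> I \<Longrightarrow> prob_space (M i)" and I: "I \<noteq> {}"
    and JK: "J \<inter> K = {}" "J \<subseteq> I" "K \<subseteq> I"
    and [measurable]: "f \<in> borel_measurable (PiM J M)" "g \<in> borel_measurable (PiM K M)"
    and int: "integrable (PiM I M) (\<lambda>x. f (restrict x J))" "integrable (PiM I M) (\<lambda>x. g (restrict x K))"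
  shows "(\<integral>x. f (restrict x J) * g (restrict x K) \<partial>PiM I M) =
    (\<integral>x. f (restrict x J) \<partial>PiM I M) * (\<integral>x. g (restrict x K) \<partial>PiM I M)"
proof -
  interpret prob_space "PiM I M"
    by (rule prob_space_PiM) (rule prob)
  \<comment> \<open>On the product space the map that collects all coordinates is the identity, so
    the joint law of the coordinates is the product measure itself; this is the criterion for
    independence.\<close>
  have "distr (PiM I M) (PiM I M) (\<lambda>x. \<lambda>i\<in>I. x i) = distr (PiM I M) (PiM I M) (\<lambda>x. x)"
    by (rule distr_cong) (auto simp: space_PiM PiE_iff extensional_restrict)
  then have "indep_vars M (\<lambda>i x. x i) I"
    using I by (subst indep_vars_iff_distr_eq_PiM') (auto simp: distr_PiM_component prob intro!: PiM_cong)
  then have "indep_var (PiM J M) (\<lambda>x. restrict x J) (PiM K M) (\<lambda>x. restrict x K)"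
    using indep_var_restrict[OF _ JK, of M "\<lambda>i x. x i"] by simp
  then have "indep_var borel (f \<circ> (\<lambda>x. restrict x J)) borel (g \<circ> (\<lambda>x. restrict x K))"
    by (rule indep_var_compose) fact+
  then show ?thesis
    using int by (intro indep_var_lebesgue_integral) (simp_all add: comp_def)
qed

section \<open>Covariances given the number of atoms\<close>

text \<open>Turns a row into a subset of the index set, the form in which the moment formula expects
  its denominator.\<close>

lemma sum_row: "(\<Sum>r=1..n. S (j, r)) = (\<Sum>i\<in>{j} \<times> {1..n}. S i)"
  for S :: "nat \<times> nat \<Rightarrow> real" and n :: nat
  by (simp add: sum.cartesian_product')

definition weight :: "nat \<Rightarrow> nat \<Rightarrow> nat \<Rightarrow> (nat \<times> nat \<Rightarrow> real) \<Rightarrow> real" where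
  "weight n j m S = S (j, m) / (\<Sum>r=1..n. S (j, r))"

lemma measurable_weight:
  assumes "j \<in> {1..d}" "m \<in> {1..n}" "{j} \<times> {1..n} \<subseteq> I"
  shows "weight n j m \<in> borel_measurable (gamma_product I a)"
  unfolding weight_def[abs_def] using assms
  by (intro borel_measurable_divide borel_measurable_sum measurable_gamma_product_component) auto

lemma weight_bounds:
  assumes S: "S \<in> space (gamma_product ({1..d} \<times> {1..n}) a)" and jm: "j \<in> {1..d}" "m \<in> {1..n}"
  shows "0 < weight n j m S" "weight n j m S \<le> 1" "(\<Sum>r=1..n. weight n j r S) = 1"
proof -
  have pos: "S (j, r) > 0" if "r \<in> {1..n}" for r
    using S jm that by (auto simp: space_PiM PiE_iff)
  have sum: "(\<Sum>r=1..n. S (j, r)) > 0"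
    using pos jm by (intro sum_pos) auto
  have "S (j, m) \<le> (\<Sum>r=1..n. S (j, r))"
    using jm by (intro member_le_sum) (auto intro!: less_imp_le pos)
  with sum pos[of m] jm show "0 < weight n j m S" "weight n j m S \<le> 1"
    by (auto simp: weight_def)
  show "(\<Sum>r=1..n. weight n j r S) = 1"
    using sum by (simp add: weight_def sum_divide_distrib[symmetric])
qed

section \<open>Moments of the weights, within one row and across rows\<close>

context
  fixes d n :: nat and \<gamma> :: "nat \<Rightarrow> real"
  assumes \<gamma>: "\<And>i. \<gamma> i > 0"
begin

abbreviation "weights_law \<equiv> gamma_product ({1..d} \<times> {1..n}) (\<lambda>i. \<gamma> (fst i))"

lemma prob_space_weights_law: "prob_space weights_law"
  by (intro prob_space_PiM prob_space_gamma_distribution \<gamma>)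

lemma measurable_weight_weights_law:
  assumes "j \<in> {1..d}" "m \<in> {1..n}"
  shows "weight n j m \<in> borel_measurable weights_law"
  using assms by (intro measurable_weight[where d = d]) auto

lemma integrable_weight_mult:
  assumes jm: "j \<in> {1..d}" "m \<in> {1..n}" and lr: "l \<in> {1..d}" "r \<in> {1..n}"
  shows "integrable weights_law (\<lambda>S. weight n j m S * weight n l r S)"
proof -
  interpret prob_space weights_law by (rule prob_space_weights_law)
  show ?thesis
  proof (rule integrable_const_bound[where B = 1])
    show "AE S in weights_law. norm (weight n j m S * weight n l r S) \<le> 1"
    proof (rule AE_I2)
      fix S assume S: "S \<in> space weights_law"
      show "norm (weight n j m S * weight n l r S) \<le> 1"
        using weight_bounds(1,2)[OF S jm] weight_bounds(1,2)[OF S lr]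
        by (simp add: abs_mult mult_le_one)
    qed
    show "(\<lambda>S. weight n j m S * weight n l r S) \<in> borel_measurable weights_law"
      using assms by (intro borel_measurable_times measurable_weight_weights_law)
  qed
qed

lemma integrable_weight:
  assumes jm: "j \<in> {1..d}" "m \<in> {1..n}"
  shows "integrable weights_law (weight n j m)"
proof -
  interpret prob_space weights_law by (rule prob_space_weights_law)
  show ?thesis
  proof (rule integrable_const_bound[where B = 1])
    show "AE S in weights_law. norm (weight n j m S) \<le> 1"
    proof (rule AE_I2)
      fix S assume S: "S \<in> space weights_law"
      show "norm (weight n j m S) \<le> 1"
        using weight_bounds(1,2)[OF S jm] by simp
    qed
  qed (rule measurable_weight_weights_law[OF jm])
qed

lemma expectation_weight_power:
  assumes jm: "j \<in> {1..d}" "m \<in> {1..n}"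
  shows "(\<integral>S. weight n j m S ^ Suc k \<partial>weights_law) = pochhammer (\<gamma> j) (Suc k) / pochhammer (n * \<gamma> j) (Suc k)"
proof -
  have "(\<Sum>i\<in>{j} \<times> {1..n}. \<gamma> (fst i)) = n * \<gamma> j"
    by (simp add: sum.cartesian_product')
  moreover have "{j} \<times> {1..n} \<subseteq> {1..d} \<times> {1..n}" "(j, m) \<in> {j} \<times> {1..n}"
    using jm by auto
  note gamma_product_normalized_expectation[where a = "\<lambda>i. \<gamma> (fst i)" and k = k, OF _ \<gamma> this]
  ultimately show ?thesis
    by (simp only: weight_def sum_row fst_conv finite_cartesian_product finite_atLeastAtMost)
qed

lemma expectation_weight:
  assumes "j \<in> {1..d}" "m \<in> {1..n}"
  shows "(\<integral>S. weight n j m S \<partial>weights_law) = 1 / n"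
  using expectation_weight_power[OF assms, of 0] \<gamma>[of j] by simp

lemma expectation_weight_mult_other_row:
  assumes jm: "j \<in> {1..d}" "m \<in> {1..n}" and lr: "l \<in> {1..d}" "r \<in> {1..n}" and "j \<noteq> l"
  shows "(\<integral>S. weight n j m S * weight n l r S \<partial>weights_law) = 1 / n * (1 / n)"
proof -
  \<comment> \<open>A weight reads only its own row, so it is a function of that block of
    coordinates and the disjoint-block product rule applies.\<close>
  have *: "weight n j m (restrict S ({j} \<times> {1..n})) = weight n j m S" if "m \<in> {1..n}" for j m S
    using that by (auto simp: weight_def intro!: arg_cong2[where f = "(/)"] sum.cong)
  have "(\<integral>S. weight n j m (restrict S ({j} \<times> {1..n})) * weight n l r (restrict S ({l} \<times> {1..n})) \<partial>weights_law) =
    (\<integral>S. weight n j m (restrict S ({j} \<times> {1..n})) \<partial>weights_law) * (\<integral>S. weight n l r (restrict S ({l} \<times> {1..n})) \<partial>weights_law)"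
  proof (rule integral_PiM_mult_disjoint)
    show "integrable weights_law (\<lambda>S. weight n j m (restrict S ({j} \<times> {1..n})))"
      "integrable weights_law (\<lambda>S. weight n l r (restrict S ({l} \<times> {1..n})))"
      using jm lr by (simp_all only: * integrable_weight)
  qed (use assms in \<open>auto intro!: measurable_weight[where d = d] prob_space_gamma_distribution \<gamma>\<close>)
  then show ?thesis
    using jm lr by (simp only: * expectation_weight)
qed

text \<open>On one row the second moment is g(g+1)/(ng(ng+1)) with g = \<open>\<gamma> j\<close>,
  and n equal terms give (g+1)/(ng+1). Across rows the n terms are 1/n^2 each.\<close>

lemma sum_expectation_weight_mult:
  assumes n: "n \<ge> 1" and jl: "j \<in> {1..d}" "l \<in> {1..d}"
  shows "(\<Sum>m=1..n. \<integral>S. weight n j m S * weight n l m S \<partial>weights_law) =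
    (if j = l then (\<gamma> j + 1) / (n * \<gamma> j + 1) else 1 / n)"
proof (cases "j = l")
  case True
  have "(\<integral>S. weight n j m S * weight n l m S \<partial>weights_law) = (\<gamma> j + 1) / (n * (n * \<gamma> j + 1))" if "m \<in> {1..n}" for m
    using expectation_weight_power[OF jl(1) that, of 1] True \<gamma>[of j] n
    by (simp add: power2_eq_square pochhammer_Suc)
  then show ?thesis
    using True n by simp
next
  case False
  then show ?thesis
    using n jl expectation_weight_mult_other_row by simp
qed

end

text \<open>Distinct atoms are independent and centred, so the factor at \<open>m\<close> already
  kills the product; a coinciding pair leaves the variance of a Bernoulli variable.\<close>

lemma (in prob_space) centred_indicator_moment:
  assumes A: "A \<in> sets M" and I: "finite I" "m \<in> I" "r \<in> I"
  shows "(\<integral>x. (indicator A (x m) - prob A) * (indicator A (x r) - prob A) \<partial>PiM I (\<lambda>_. M)) =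
    (if m = r then prob A * (1 - prob A) else 0)"
proof -
  interpret PP: product_prob_space "\<lambda>_. M" by (intro product_prob_spaceI prob_space_axioms)
  let ?Y = "\<lambda>x. indicator A x - prob A"
  have intY: "integrable M ?Y" using A by (intro Bochner_Integration.integrable_diff integrable_const integrable_real_indicator) (simp_all add: emeasure_eq_measure)
  have EY: "(\<integral>x. ?Y x \<partial>M) = 0"
    using A by (subst Bochner_Integration.integral_diff) (auto simp: prob_space emeasure_eq_measure)
  \<comment> \<open>An indicator equals its own square, so the squared centred indicator is affine
    in the indicator and is integrated by linearity.\<close>
  have sq: "?Y x * ?Y x = (1 - 2 * prob A) * indicator A x + prob A ^ 2" for x
    by (simp add: indicator_def power2_eq_square algebra_simps)
  have int2: "integrable M (\<lambda>x. ?Y x * ?Y x)"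
    unfolding sq using A by (intro Bochner_Integration.integrable_add integrable_mult_right integrable_real_indicator integrable_const) (simp_all add: emeasure_eq_measure)
  have EY2: "(\<integral>x. ?Y x * ?Y x \<partial>M) = prob A * (1 - prob A)"
    unfolding sq using A by (subst Bochner_Integration.integral_add) (auto simp: prob_space power2_eq_square algebra_simps emeasure_eq_measure)
  \<comment> \<open>Two separate conditional factors treat both cases by one product over
    coordinates: they meet in a square if \<open>m = r\<close> and sit at different coordinates
    otherwise.\<close>
  let ?f = "\<lambda>i x. (if i = m then ?Y x else 1) * (if i = r then ?Y x else 1)"
  have "(\<integral>x. ?Y (x m) * ?Y (x r) \<partial>PiM I (\<lambda>_. M)) = (\<integral>x. (\<Prod>i\<in>I. ?f i (x i)) \<partial>PiM I (\<lambda>_. M))"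
    using I by (simp add: prod.distrib)
  also have "\<dots> = (\<Prod>i\<in>I. \<integral>x. ?f i x \<partial>M)"
  proof (intro PP.product_integral_prod I)
    fix i
    show "integrable M (?f i)"
      using intY int2 by (cases "i = m"; cases "i = r") simp_all
  qed
  also have "\<dots> = (if m = r then prob A * (1 - prob A) else 0)"
  proof (cases "m = r")
    case True
    have "(\<Prod>i\<in>I. \<integral>x. ?f i x \<partial>M) = (\<Prod>i\<in>I. if i = m then prob A * (1 - prob A) else 1)"
      using EY2 prob_space by (intro prod.cong refl) (auto simp: True)
    with True I show ?thesis by simp
  next
    case False
    then have "(\<integral>x. ?f m x \<partial>M) = 0" using EY by simp
    then have "(\<Prod>i\<in>I. \<integral>x. ?f i x \<partial>M) = 0"
      using I by (intro prod_zero) blast+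
    with False show ?thesis by simp
  qed
  finally show ?thesis .
qed

lemma (in prob_space) centred_indicator_mean:
  assumes A[measurable]: "A \<in> sets M" and I: "m \<in> I"
  shows "(\<integral>x. indicator A (x m) - prob A \<partial>PiM I (\<lambda>_. M)) = 0"
proof -
  have "(\<integral>x. indicator A (x m) - prob A \<partial>PiM I (\<lambda>_. M)) =
    (\<integral>y. indicator A y - prob A \<partial>distr (PiM I (\<lambda>_. M)) M (\<lambda>x. x m))"
    using I by (intro integral_distr[symmetric]) auto
  also have "\<dots> = (\<integral>y. indicator A y - prob A \<partial>M)"
    using I by (subst distr_PiM_component) (auto intro: prob_space_axioms)
  also have "\<dots> = 0"
    using A by (subst Bochner_Integration.integral_diff) (auto simp: prob_space emeasure_eq_measure)
  finally show ?thesis .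
qed

lemma measure_normalized_measures:
  assumes \<tau>S: "(\<tau>, S) \<in> space (atoms_and_weights d \<gamma> P\<^sub>0 n)" and A: "A \<in> sets P\<^sub>0"
    and j: "j \<in> {1..d}"
  shows "measure (normalized_measures d P\<^sub>0 n (\<tau>, S) j) A = (\<Sum>m=1..n. weight n j m S * indicator A (\<tau> m))"
proof -
  have S: "S (j, m) > 0" if "m \<in> {1..n}" for m
    using \<tau>S j that by (auto simp: atoms_and_weights_def space_pair_measure space_PiM PiE_iff)
  have w: "weight n j m S \<ge> 0" if "m \<in> {1..n}" for m
    unfolding weight_def using S that by (intro divide_nonneg_nonneg sum_nonneg) (auto intro: less_imp_le)
  have "emeasure (normalized_measures d P\<^sub>0 n (\<tau>, S) j) A = (\<Sum>m=1..n. ennreal (weight n j m S) * indicator A (\<tau> m))"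
    using j A by (simp add: normalized_measures_def emeasure_discrete_measure weight_def)
  also have "\<dots> = (\<Sum>m=1..n. ennreal (weight n j m S * indicator A (\<tau> m)))"
    by (intro sum.cong refl) (simp add: indicator_def)
  also have "\<dots> = ennreal (\<Sum>m=1..n. weight n j m S * indicator A (\<tau> m))"
    using w by (intro sum_ennreal) auto
  finally have "emeasure (normalized_measures d P\<^sub>0 n (\<tau>, S) j) A = \<dots>" .
  moreover have "(\<Sum>m=1..n. weight n j m S * indicator A (\<tau> m)) \<ge> 0"
    using w by (intro sum_nonneg mult_nonneg_nonneg) auto
  ultimately show ?thesis
    by (simp only: measure_def enn2real_ennreal)
qed

lemma atoms_and_weights_eq:
  "atoms_and_weights d \<gamma> P\<^sub>0 n =
    PiM {1..n} (\<lambda>_. P\<^sub>0) \<Otimes>\<^sub>M gamma_product ({1..d} \<times> {1..n}) (\<lambda>i. \<gamma> (fst i))"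
  unfolding atoms_and_weights_def by (simp add: case_prod_beta')

lemma measurable_evaluation:
  assumes "A \<in> sets P\<^sub>0" "j \<in> {1..d}"
  shows "(\<lambda>p. measure (p j) A) \<in> borel_measurable (prob_tuples d P\<^sub>0)"
proof -
  have "(\<lambda>p. p j) \<in> prob_tuples d P\<^sub>0 \<rightarrow>\<^sub>M prob_algebra P\<^sub>0"
    unfolding prob_tuples_def using assms(2) by measurable
  then have "(\<lambda>p. p j) \<in> prob_tuples d P\<^sub>0 \<rightarrow>\<^sub>M subprob_algebra P\<^sub>0"
    by (rule measurable_prob_algebraD)
  then show ?thesis
    by (rule measurable_compose[OF _ measurable_measure_subprob_algebra[OF assms(1)]])
qed

lemma evaluation_bounds:
  assumes "p \<in> space (prob_tuples d P\<^sub>0)" "j \<in> {1..d}"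
  shows "0 \<le> measure (p j) A" "measure (p j) A \<le> 1"
proof -
  have "prob_space (p j)"
    using assms by (auto simp: prob_tuples_def space_PiM space_prob_algebra PiE_iff)
  then show "measure (p j) A \<le> 1"
    by (rule prob_space.prob_le_1)
qed simp

lemma integral_pair_mult:
  fixes f :: "'a \<Rightarrow> real" and g :: "'b \<Rightarrow> real"
  assumes M: "prob_space M" and N: "prob_space N"
    and f: "integrable M f" and g: "integrable N g"
  shows "integrable (M \<Otimes>\<^sub>M N) (\<lambda>x. f (fst x) * g (snd x))"
    and "(\<integral>x. f (fst x) * g (snd x) \<partial>(M \<Otimes>\<^sub>M N)) = (\<integral>x. f x \<partial>M) * (\<integral>x. g x \<partial>N)"
proof -
  interpret M: prob_space M by fact
  interpret N: prob_space N by fact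
  interpret pair_prob_space M N ..
  have [measurable]: "f \<in> borel_measurable M" "g \<in> borel_measurable N"
    using f g by auto
  show *: "integrable (M \<Otimes>\<^sub>M N) (\<lambda>x. f (fst x) * g (snd x))"
    using f g by (intro Fubini_integrable) (auto simp: abs_mult)
  show "(\<integral>x. f (fst x) * g (snd x) \<partial>(M \<Otimes>\<^sub>M N)) = (\<integral>x. f x \<partial>M) * (\<integral>x. g x \<partial>N)"
    using integral_fst'[OF *] by simp
qed

section \<open>Mean and covariance of the evaluations for a fixed number of atoms\<close>

context
  fixes d n :: nat and \<gamma> :: "nat \<Rightarrow> real" and P\<^sub>0 :: "'a measure" and A :: "'a set"
  assumes \<gamma>: "\<And>i. \<gamma> i > 0" and P0: "prob_space P\<^sub>0" and A: "A \<in> sets P\<^sub>0" and n: "n \<ge> 1"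
begin

interpretation P0: prob_space P\<^sub>0 by (rule P0)

lemma integrable_centred_indicator_mult:
  assumes [measurable]: "m \<in> {1..n}" "r \<in> {1..n}"
  shows "integrable (PiM {1..n} (\<lambda>_. P\<^sub>0))
    (\<lambda>x. (indicator A (x m) - measure P\<^sub>0 A) * (indicator A (x r) - measure P\<^sub>0 A) :: real)"
    "integrable (PiM {1..n} (\<lambda>_. P\<^sub>0)) (\<lambda>x. indicator A (x m) - measure P\<^sub>0 A :: real)"
proof -
  interpret Q: prob_space "PiM {1..n} (\<lambda>_. P\<^sub>0)" by (intro prob_space_PiM P0)
  have *: "\<bar>indicator A x - measure P\<^sub>0 A\<bar> \<le> 1" for x
    using P0.prob_le_1[of A] measure_nonneg[of P\<^sub>0 A] by (auto simp: indicator_def)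
  note A[measurable]
  show "integrable (PiM {1..n} (\<lambda>_. P\<^sub>0)) (\<lambda>x. (indicator A (x m) - measure P\<^sub>0 A) * (indicator A (x r) - measure P\<^sub>0 A) :: real)"
    using * by (intro Q.integrable_const_bound[where B = 1]) (simp add: abs_mult mult_le_one, measurable)
  show "integrable (PiM {1..n} (\<lambda>_. P\<^sub>0)) (\<lambda>x. indicator A (x m) - measure P\<^sub>0 A :: real)"
    using * by (intro Q.integrable_const_bound[where B = 1]) (simp, measurable)
qed

lemma measure_normalized_measures_centred:
  assumes x: "x \<in> space (atoms_and_weights d \<gamma> P\<^sub>0 n)" and j: "j \<in> {1..d}"
  shows "measure (normalized_measures d P\<^sub>0 n x j) A - measure P\<^sub>0 A =
    (\<Sum>m=1..n. weight n j m (snd x) * (indicator A (fst x m) - measure P\<^sub>0 A))"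
proof -
  have "snd x \<in> space (gamma_product ({1..d} \<times> {1..n}) (\<lambda>i. \<gamma> (fst i)))"
    using x by (auto simp: atoms_and_weights_eq space_pair_measure)
  \<comment> \<open>The normalisation fact asks for some column index; 1 is available because
    \<open>n \<ge> 1\<close>.\<close>
  then have 1: "(\<Sum>m=1..n. weight n j m (snd x)) = 1"
    using weight_bounds(3)[OF _ j, of _ _ _ 1] n by auto
  have "measure (normalized_measures d P\<^sub>0 n x j) A = (\<Sum>m=1..n. weight n j m (snd x) * indicator A (fst x m))"
    using measure_normalized_measures[of "fst x" "snd x", OF _ A j] x by simp
  then show ?thesis
    using 1 by (simp add: right_diff_distrib sum_subtractf sum_distrib_right[symmetric])
qed

text \<open>Each term pairs a centred atom with an independent weight and so has mean 0, whatever
  the law of the weights.\<close>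

lemma vec_fdp_given_mean:
  assumes j: "j \<in> {1..d}"
  shows "(\<integral>p. measure (p j) A - measure P\<^sub>0 A \<partial>vec_fdp_given d \<gamma> P\<^sub>0 n) = 0"
proof -
  let ?Y = "\<lambda>m x. indicator A (x m) - measure P\<^sub>0 A :: real"
  let ?W = "gamma_product ({1..d} \<times> {1..n}) (\<lambda>i. \<gamma> (fst i))"
  have Q: "prob_space (PiM {1..n} (\<lambda>_. P\<^sub>0))" by (intro prob_space_PiM P0)
  note [measurable] = measurable_evaluation[OF A j]
  have "(\<integral>p. measure (p j) A - measure P\<^sub>0 A \<partial>vec_fdp_given d \<gamma> P\<^sub>0 n) =
     (\<integral>x. measure (normalized_measures d P\<^sub>0 n x j) A - measure P\<^sub>0 A \<partial>atoms_and_weights d \<gamma> P\<^sub>0 n)"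
    unfolding vec_fdp_given_def
    by (intro integral_distr measurable_normalized_measures n) measurable
  also have "\<dots> = (\<integral>x. (\<Sum>m=1..n. ?Y m (fst x) * weight n j m (snd x)) \<partial>atoms_and_weights d \<gamma> P\<^sub>0 n)"
    by (intro Bochner_Integration.integral_cong refl)
       (simp only: measure_normalized_measures_centred[OF _ j] mult.commute)
  also have "\<dots> = (\<Sum>m=1..n. \<integral>x. ?Y m (fst x) * weight n j m (snd x) \<partial>atoms_and_weights d \<gamma> P\<^sub>0 n)"
    unfolding atoms_and_weights_eq
    by (intro Bochner_Integration.integral_sum integral_pair_mult(1) Q prob_space_weights_law \<gamma>
        integrable_centred_indicator_mult(2) integrable_weight j)
  also have "\<dots> = (\<Sum>m=1..n. (\<integral>x. ?Y m x \<partial>PiM {1..n} (\<lambda>_. P\<^sub>0)) * (\<integral>S. weight n j m S \<partial>?W))"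
    unfolding atoms_and_weights_eq
    by (intro sum.cong refl integral_pair_mult(2) Q prob_space_weights_law \<gamma>
        integrable_centred_indicator_mult(2) integrable_weight j)
  also have "\<dots> = 0"
    by (simp add: P0.centred_indicator_mean A)
  finally show ?thesis .
qed

text \<open>The same atoms serve all rows, so the products of centred indicators are the same for
  every pair \<open>j\<close>, \<open>l\<close>; the choice of rows is felt only through the weights
  that multiply them.\<close>

lemma vec_fdp_given_covariance:
  assumes j: "j \<in> {1..d}" and l: "l \<in> {1..d}"
  shows "(\<integral>p. (measure (p j) A - measure P\<^sub>0 A) * (measure (p l) A - measure P\<^sub>0 A) \<partial>vec_fdp_given d \<gamma> P\<^sub>0 n) =
    measure P\<^sub>0 A * (1 - measure P\<^sub>0 A) * (if j = l then (\<gamma> j + 1) / (n * \<gamma> j + 1) else 1 / n)"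
proof -
  let ?p = "measure P\<^sub>0 A"
  let ?Y = "\<lambda>m x. indicator A (x m) - ?p :: real"
  let ?w = "\<lambda>m r S. weight n j m S * weight n l r S"
  let ?W = "gamma_product ({1..d} \<times> {1..n}) (\<lambda>i. \<gamma> (fst i))"
  have Q: "prob_space (PiM {1..n} (\<lambda>_. P\<^sub>0))" by (intro prob_space_PiM P0)
  note [measurable] = measurable_evaluation[OF A j] measurable_evaluation[OF A l]
  have "(\<integral>p. (measure (p j) A - ?p) * (measure (p l) A - ?p) \<partial>vec_fdp_given d \<gamma> P\<^sub>0 n) =
     (\<integral>x. (measure (normalized_measures d P\<^sub>0 n x j) A - ?p) * (measure (normalized_measures d P\<^sub>0 n x l) A - ?p)
       \<partial>atoms_and_weights d \<gamma> P\<^sub>0 n)"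
    unfolding vec_fdp_given_def
    by (intro integral_distr measurable_normalized_measures n) measurable
  also have "\<dots> = (\<integral>x. (\<Sum>m=1..n. \<Sum>r=1..n. (?Y m (fst x) * ?Y r (fst x)) * ?w m r (snd x)) \<partial>atoms_and_weights d \<gamma> P\<^sub>0 n)"
    by (intro Bochner_Integration.integral_cong refl)
       (simp only: measure_normalized_measures_centred[OF _ j] measure_normalized_measures_centred[OF _ l], simp only: sum_product mult_ac)
  also have "\<dots> = (\<Sum>m=1..n. \<integral>x. (\<Sum>r=1..n. (?Y m (fst x) * ?Y r (fst x)) * ?w m r (snd x)) \<partial>atoms_and_weights d \<gamma> P\<^sub>0 n)"
    unfolding atoms_and_weights_eq
    by (intro Bochner_Integration.integral_sum Bochner_Integration.integrable_sum integral_pair_mult(1) Q prob_space_weights_law \<gamma>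
        integrable_centred_indicator_mult(1) integrable_weight_mult j l)
  also have "\<dots> = (\<Sum>m=1..n. \<Sum>r=1..n. \<integral>x. (?Y m (fst x) * ?Y r (fst x)) * ?w m r (snd x) \<partial>atoms_and_weights d \<gamma> P\<^sub>0 n)"
    unfolding atoms_and_weights_eq
    by (intro sum.cong refl Bochner_Integration.integral_sum integral_pair_mult(1) Q prob_space_weights_law \<gamma>
        integrable_centred_indicator_mult(1) integrable_weight_mult j l)
  also have "\<dots> = (\<Sum>m=1..n. \<Sum>r=1..n. (\<integral>x. ?Y m x * ?Y r x \<partial>PiM {1..n} (\<lambda>_. P\<^sub>0)) * (\<integral>S. ?w m r S \<partial>?W))"
    unfolding atoms_and_weights_eq
    by (intro sum.cong refl integral_pair_mult(2) Q prob_space_weights_law \<gamma>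
        integrable_centred_indicator_mult(1) integrable_weight_mult j l)
  \<comment> \<open>Orthogonality of the centred indicators collapses the double sum, so mixed
    moments of weights in different columns never have to be computed.\<close>
  also have "\<dots> = (\<Sum>m=1..n. \<Sum>r=1..n. (if m = r then ?p * (1 - ?p) else 0) * (\<integral>S. ?w m r S \<partial>?W))"
    by (intro sum.cong refl) (simp only: P0.centred_indicator_moment[OF A finite_atLeastAtMost])
  also have "\<dots> = (\<Sum>m=1..n. ?p * (1 - ?p) * (\<integral>S. ?w m m S \<partial>?W))"
    by (intro sum.cong refl) (simp add: if_distrib[of "\<lambda>c. c * _"] cong: if_cong)
  also have "\<dots> = ?p * (1 - ?p) * (\<Sum>m=1..n. \<integral>S. ?w m m S \<partial>?W)"
    by (simp only: sum_distrib_left)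
  also have "\<dots> = ?p * (1 - ?p) * (if j = l then (\<gamma> j + 1) / (n * \<gamma> j + 1) else 1 / n)"
    by (simp only: sum_expectation_weight_mult[where \<gamma> = \<gamma>, OF \<gamma> n j l])
  finally show ?thesis .
qed

end

section \<open>Poisson averages\<close>

text \<open>A bind is the join of the image of \<open>M\<close> under the kernel, and the integral
  over a join is iterated. Boundedness is the convenient hypothesis because all integrands here are
  built from values of probability measures.\<close>

lemma integral_bind_bounded:
  fixes f :: "'b \<Rightarrow> real"
  assumes M: "prob_space M" and N: "N \<in> M \<rightarrow>\<^sub>M prob_algebra B"
    and f: "f \<in> borel_measurable B" and bnd: "\<And>x. x \<in> space B \<Longrightarrow> \<bar>f x\<bar> \<le> C"
  shows "(\<integral>x. f x \<partial>(M \<bind> N)) = (\<integral>x. (\<integral>y. f y \<partial>N x) \<partial>M)"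
proof -
  interpret M: prob_space M by fact
  have N': "N \<in> M \<rightarrow>\<^sub>M subprob_algebra B"
    using N by (rule measurable_prob_algebraD)
  have "(\<integral>x. f x \<partial>(M \<bind> N)) = (\<integral>x. f x \<partial>join (distr M (subprob_algebra B) N))"
    by (subst bind_nonempty''[OF N' M.not_empty]) simp
  also have "\<dots> = (\<integral>M'. (\<integral>x. f x \<partial>M') \<partial>distr M (subprob_algebra B) N)"
  proof (rule integral_join[where B = C and B' = 1])
    show "finite_measure (distr M (subprob_algebra B) N)"
      using M.prob_space_distr[OF N'] by (rule prob_space.finite_measure)
    have "subprob_space (N x)" if "x \<in> space M" for x
      using measurable_space[OF N' that] by (simp add: space_subprob_algebra)
    then show "AE M' in distr M (subprob_algebra B) N. emeasure M' (space M') \<le> ennreal 1"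
      by (subst AE_distr_iff[OF N']) (auto intro: subprob_space.subprob_emeasure_le_1)
  qed (use f bnd in auto)
  also have "\<dots> = (\<integral>x. (\<integral>y. f y \<partial>N x) \<partial>M)"
    using f by (intro integral_distr N' integral_measurable_subprob_algebra)
  finally show ?thesis .
qed

section \<open>Series for Poisson expectations\<close>

context
  fixes \<Lambda> :: real
  assumes \<Lambda>: "\<Lambda> > 0"
begin

text \<open>For nonnegative \<open>f\<close> the series can be summed as an extended real, so one
  convergent real series delivers integrability and the value together.\<close>

lemma poisson_expectation_sums:
  fixes f :: "nat \<Rightarrow> real"
  assumes f: "\<And>k. 0 \<le> f k" and s: "(\<lambda>k. \<Lambda> ^ k / fact k * exp (- \<Lambda>) * f k) sums c"
  shows "integrable (measure_pmf (poisson_pmf \<Lambda>)) f" "measure_pmf.expectation (poisson_pmf \<Lambda>) f = c"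
proof -
  have "(\<integral>\<^sup>+k. ennreal (f k) \<partial>measure_pmf (poisson_pmf \<Lambda>)) =
      (\<integral>\<^sup>+k. ennreal (\<Lambda> ^ k / fact k * exp (- \<Lambda>) * f k) \<partial>count_space UNIV)"
    unfolding nn_integral_measure_pmf using \<Lambda> f
    by (intro nn_integral_cong) (simp only: pmf_poisson[OF \<Lambda>] ennreal_mult''[OF f])
  also have "\<dots> = (\<Sum>k. ennreal (\<Lambda> ^ k / fact k * exp (- \<Lambda>) * f k))"
    by (rule nn_integral_count_space_nat)
  also have "\<dots> = ennreal c"
    using s \<Lambda> f by (subst suminf_ennreal2) (auto simp: sums_iff)
  finally have nn: "(\<integral>\<^sup>+k. ennreal (f k) \<partial>measure_pmf (poisson_pmf \<Lambda>)) = ennreal c" .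
  have "c \<ge> 0"
    using s \<Lambda> f by (auto simp: sums_iff intro!: suminf_nonneg)
  with nn f have "has_bochner_integral (measure_pmf (poisson_pmf \<Lambda>)) f c"
    by (intro has_bochner_integral_nn_integral) auto
  then show "integrable (measure_pmf (poisson_pmf \<Lambda>)) f" "measure_pmf.expectation (poisson_pmf \<Lambda>) f = c"
    by (auto simp: has_bochner_integral_iff)
qed

lemma poisson_expectation_inverse_Suc:
  "measure_pmf.expectation (poisson_pmf \<Lambda>) (\<lambda>k. 1 / real (Suc k)) = (1 - exp (- \<Lambda>)) / \<Lambda>"
proof (rule poisson_expectation_sums)
  \<comment> \<open>Since k!(k+1) = (k+1)!, the wanted series is the exponential series without its
    first term 1, up to a factor \<open>exp (- \<Lambda>) / \<Lambda>\<close>.\<close>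
  have "(\<lambda>k. \<Lambda> ^ Suc k / fact (Suc k)) sums (exp \<Lambda> - 1)"
    using exp_converges[of \<Lambda>] sums_Suc_iff[of "\<lambda>k. \<Lambda> ^ k / fact k" "exp \<Lambda> - 1"]
    by (simp add: divide_inverse mult.commute)
  from sums_mult[OF this, of "exp (- \<Lambda>) / \<Lambda>"]
  show "(\<lambda>k. \<Lambda> ^ k / fact k * exp (- \<Lambda>) * (1 / real (Suc k))) sums ((1 - exp (- \<Lambda>)) / \<Lambda>)"
    using \<Lambda> by (simp add: exp_minus field_simps)
qed simp

text \<open>With M = k+1 this is E[M x^(M-1)], the derivative of the generating function x
  exp(-\<Lambda>(1-x)) and the first part of the integrand of \<open>fdp_I\<close>. The splitting
  k+1 = 1+k reduces it to two exponential series, with no termwise differentiation.\<close>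

lemma poisson_pgf_derivative_sums:
  "(\<lambda>k. \<Lambda> ^ k / fact k * exp (- \<Lambda>) * (real (Suc k) * x ^ k)) sums ((1 + \<Lambda> * x) * exp (- \<Lambda> * (1 - x)))"
proof -
  have e: "(\<lambda>k. (\<Lambda> * x) ^ k / fact k) sums exp (\<Lambda> * x)"
    using exp_converges[of "\<Lambda> * x"] by (simp add: divide_inverse mult.commute)
  have "(\<lambda>k. \<Lambda> * x * ((\<Lambda> * x) ^ k / fact k)) sums (\<Lambda> * x * exp (\<Lambda> * x))"
    by (rule sums_mult[OF e])
  also have "(\<lambda>k. \<Lambda> * x * ((\<Lambda> * x) ^ k / fact k)) = (\<lambda>k. real (Suc k) * (\<Lambda> * x) ^ Suc k / fact (Suc k))"
    by (simp add: fun_eq_iff del: of_nat_Suc)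
  \<comment> \<open>The term at k = 0 vanishes, so undoing the shift leaves the sum
    unchanged.\<close>
  finally have "(\<lambda>k. real k * (\<Lambda> * x) ^ k / fact k) sums (\<Lambda> * x * exp (\<Lambda> * x))"
    using sums_Suc_iff[of "\<lambda>k. real k * (\<Lambda> * x) ^ k / fact k" "\<Lambda> * x * exp (\<Lambda> * x)"] by simp
  from sums_mult[OF sums_add[OF e this], of "exp (- \<Lambda>)"]
  have "(\<lambda>k. exp (- \<Lambda>) * ((\<Lambda> * x) ^ k / fact k + real k * (\<Lambda> * x) ^ k / fact k)) sums
    (exp (- \<Lambda>) * (exp (\<Lambda> * x) + \<Lambda> * x * exp (\<Lambda> * x)))" .
  also have "exp (- \<Lambda>) * (exp (\<Lambda> * x) + \<Lambda> * x * exp (\<Lambda> * x)) = (1 + \<Lambda> * x) * (exp (- \<Lambda>) * exp (\<Lambda> * x))"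
    by (simp add: algebra_simps)
  also have "exp (- \<Lambda>) * exp (\<Lambda> * x) = exp (- \<Lambda> * (1 - x))"
    by (simp add: exp_add[symmetric] algebra_simps)
  also have "(\<lambda>k. exp (- \<Lambda>) * ((\<Lambda> * x) ^ k / fact k + real k * (\<Lambda> * x) ^ k / fact k)) =
    (\<lambda>k. \<Lambda> ^ k / fact k * exp (- \<Lambda>) * (real (Suc k) * x ^ k))"
    by (simp add: power_mult_distrib field_simps)
  finally show ?thesis .
qed

text \<open>At x = 1 the preceding series is E[k+1]. The mean is what controls the error near shape
  parameter 0.\<close>

lemma poisson_expectation: "integrable (measure_pmf (poisson_pmf \<Lambda>)) (\<lambda>k. real k)"
  "measure_pmf.expectation (poisson_pmf \<Lambda>) (\<lambda>k. real k) = \<Lambda>"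
proof -
  have 1: "(\<lambda>k. \<Lambda> ^ k / fact k * exp (- \<Lambda>) * real (Suc k)) sums (1 + \<Lambda>)"
    using poisson_pgf_derivative_sums[of 1] by simp
  have i: "integrable (measure_pmf (poisson_pmf \<Lambda>)) (\<lambda>k. real (Suc k))"
    and e: "measure_pmf.expectation (poisson_pmf \<Lambda>) (\<lambda>k. real (Suc k)) = 1 + \<Lambda>"
    using poisson_expectation_sums[OF _ 1] by simp_all
  have "integrable (measure_pmf (poisson_pmf \<Lambda>)) (\<lambda>k. real (Suc k) - 1)"
    by (intro Bochner_Integration.integrable_diff i) simp
  then show int: "integrable (measure_pmf (poisson_pmf \<Lambda>)) (\<lambda>k. real k)"
    by simp
  with e show "measure_pmf.expectation (poisson_pmf \<Lambda>) (\<lambda>k. real k) = \<Lambda>"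
    by (simp add: Bochner_Integration.integral_add)
qed

end

text \<open>\<open>F\<close> is the termwise antiderivative, with F(0) = 0 and F(1) = 1 -
  (k+1)/(k+1+1/g); clearing the inner fraction gives 1/(g(k+1)+1).\<close>

lemma nn_integral_power_one_minus_powr:
  assumes g: "(g::real) > 0"
  shows "(\<integral>\<^sup>+x. ennreal (real (Suc k) * x ^ k * (1 - x powr (1 / g))) * indicator {0..1} x \<partial>lborel) =
    ennreal (1 / (g * Suc k + 1))"
proof -
  define F where "F = (\<lambda>x. x ^ Suc k - real (Suc k) / (real (Suc k) + 1 / g) * x powr (real (Suc k) + 1 / g))"
  have "(\<integral>\<^sup>+x. ennreal (real (Suc k) * x ^ k * (1 - x powr (1 / g))) * indicator {0..1} x \<partial>lborel) =
    (\<integral>\<^sup>+x. ennreal (indicator {0..1} x * (real (Suc k) * x ^ k * (1 - x powr (1 / g)))) \<partial>lborel)"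
    by (intro nn_integral_cong) (simp add: indicator_def)
  also have "\<dots> = ennreal (F 1 - F 0)"
  proof (intro nn_integral_has_integral_lebesgue)
    fix x :: real assume x: "x \<in> {0..1}"
    have "x powr (1 / g) \<le> 1" using x g by (intro powr_le1) auto
    then show "0 \<le> real (Suc k) * x ^ k * (1 - x powr (1 / g))"
      using x by simp
  next
    show "((\<lambda>x. real (Suc k) * x ^ k * (1 - x powr (1 / g))) has_integral F 1 - F 0) {0..1}"
    \<comment> \<open>The derivative rule for \<open>powr\<close> is applied at a positive base, so
      differentiation is confined to the open interval and continuity takes care of the end
      points.\<close>
    proof (rule fundamental_theorem_of_calculus_interior)
      show "continuous_on {0..1} F"
      proof -
        have "real (Suc k) + 1 / g > 0" using g by (intro add_nonneg_pos) auto
        then have "continuous_on {0..1} (\<lambda>x. x powr (real (Suc k) + 1 / g))"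
          by (intro continuous_on_powr' continuous_on_id continuous_on_const) auto
        then show ?thesis
          unfolding F_def
          by (intro continuous_on_diff continuous_on_mult continuous_on_power continuous_on_id continuous_on_const)
      qed
      fix x :: real assume x: "x \<in> {0<..<1}"
      have "((\<lambda>x. x ^ Suc k) has_real_derivative real (Suc k) * x ^ k) (at x)"
        using DERIV_pow[of "Suc k" x] by simp
      moreover have "((\<lambda>x. x powr (real (Suc k) + 1 / g)) has_real_derivative (real (Suc k) + 1 / g) * x powr (real (Suc k) + 1 / g - 1)) (at x)"
        using x by (intro has_real_derivative_powr) simp
      ultimately have "(F has_real_derivative
        (real (Suc k) * x ^ k - real (Suc k) / (real (Suc k) + 1 / g) * ((real (Suc k) + 1 / g) * x powr (real (Suc k) + 1 / g - 1)))) (at x)"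
        unfolding F_def by (intro DERIV_diff DERIV_cmult)
      also have "real (Suc k) / (real (Suc k) + 1 / g) * ((real (Suc k) + 1 / g) * x powr (real (Suc k) + 1 / g - 1)) =
         real (Suc k) * (x ^ k * x powr (1 / g))"
      proof -
        have "real (Suc k) + 1 / g \<noteq> 0" using g by (auto simp: add_nonneg_eq_0_iff)
        moreover have "x powr (real (Suc k) + 1 / g - 1) = x ^ k * x powr (1 / g)"
          using x by (simp add: powr_add powr_realpow)
        ultimately show ?thesis by simp
      qed
      finally show "(F has_vector_derivative real (Suc k) * x ^ k * (1 - x powr (1 / g))) (at x)"
        by (simp add: has_real_derivative_iff_has_vector_derivative algebra_simps)
    qed simp
  qed
  also have "F 1 - F 0 = 1 / (g * Suc k + 1)"
  proof -
    have "real (Suc k) + 1 / g = (g * Suc k + 1) / g" using g by (simp add: field_simps)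
    moreover have "g * Suc k + 1 > 0" using g by (intro add_nonneg_pos) auto
    ultimately show ?thesis
      using g by (simp add: F_def field_simps)
  qed
  finally show ?thesis .
qed

text \<open>On the unit interval x^(1/g) is at most 1, so all terms of the expanded integrand are
  nonnegative and the Poisson series may be exchanged with the integral without a dominating
  function.\<close>

lemma fdp_I_eq_expectation:
  assumes \<Lambda>: "\<Lambda> > 0" and g: "g > 0"
  shows "fdp_I g \<Lambda> = measure_pmf.expectation (poisson_pmf \<Lambda>) (\<lambda>k. 1 / (g * Suc k + 1))"
proof -
  let ?h = "\<lambda>x. (1 + \<Lambda> * x) * exp (- \<Lambda> * (1 - x)) * (1 - x powr (1 / g))"
  let ?t = "\<lambda>k x. real (Suc k) * x ^ k * (1 - x powr (1 / g))"
  have le: "x powr (1 / g) \<le> 1" if "x \<in> {0..1}" for x :: real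
    using that g by (intro powr_le1) auto
  have "fdp_I g \<Lambda> = (\<integral>x. indicator {0..1} x * ?h x \<partial>lborel)"
    by (simp add: fdp_I_def set_lebesgue_integral_def)
  also have "\<dots> = enn2real (\<integral>\<^sup>+x. ennreal (indicator {0..1} x * ?h x) \<partial>lborel)"
    using \<Lambda> le by (intro integral_eq_nn_integral AE_I2) (auto simp: indicator_def)
  also have "(\<integral>\<^sup>+x. ennreal (indicator {0..1} x * ?h x) \<partial>lborel) =
    (\<integral>\<^sup>+x. (\<Sum>k. ennreal (\<Lambda> ^ k / fact k * exp (- \<Lambda>)) * (ennreal (?t k x) * indicator {0..1} x)) \<partial>lborel)"
  proof (intro nn_integral_cong)
    fix x :: real
    show "ennreal (indicator {0..1} x * ?h x) = (\<Sum>k. ennreal (\<Lambda> ^ k / fact k * exp (- \<Lambda>)) * (ennreal (?t k x) * indicator {0..1} x))"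
    proof (cases "x \<in> {0..1}")
      case True
      have s: "(\<lambda>k. \<Lambda> ^ k / fact k * exp (- \<Lambda>) * ?t k x) sums ?h x"
        using sums_mult2[OF poisson_pgf_derivative_sums[OF \<Lambda>, of x], of "1 - x powr (1 / g)"] by (simp only: mult.assoc)
      have nn: "0 \<le> \<Lambda> ^ k / fact k * exp (- \<Lambda>) * ?t k x" for k
        using \<Lambda> le[OF True] True by auto
      have "(\<Sum>k. ennreal (\<Lambda> ^ k / fact k * exp (- \<Lambda>) * ?t k x)) = ennreal (?h x)"
        using s nn by (subst suminf_ennreal2) (auto simp: sums_iff)
      moreover have "ennreal (\<Lambda> ^ k / fact k * exp (- \<Lambda>) * ?t k x) = ennreal (\<Lambda> ^ k / fact k * exp (- \<Lambda>)) * ennreal (?t k x)" for k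
        by (rule ennreal_mult') (use \<Lambda> in simp)
      ultimately show ?thesis
        using True by (simp only: indicator_simps mult_1_left mult_1_right)
    qed simp
  qed
  also have "\<dots> = (\<Sum>k. \<integral>\<^sup>+x. ennreal (\<Lambda> ^ k / fact k * exp (- \<Lambda>)) * (ennreal (?t k x) * indicator {0..1} x) \<partial>lborel)"
    by (rule nn_integral_suminf) measurable
  also have "\<dots> = (\<Sum>k. ennreal (\<Lambda> ^ k / fact k * exp (- \<Lambda>)) * ennreal (1 / (g * Suc k + 1)))"
  proof (intro suminf_cong)
    fix k
    have "(\<integral>\<^sup>+x. ennreal (\<Lambda> ^ k / fact k * exp (- \<Lambda>)) * (ennreal (?t k x) * indicator {0..1} x) \<partial>lborel) =
      ennreal (\<Lambda> ^ k / fact k * exp (- \<Lambda>)) * (\<integral>\<^sup>+x. ennreal (?t k x) * indicator {0..1} x \<partial>lborel)"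
      by (rule nn_integral_cmult) measurable
    then show "(\<integral>\<^sup>+x. ennreal (\<Lambda> ^ k / fact k * exp (- \<Lambda>)) * (ennreal (?t k x) * indicator {0..1} x) \<partial>lborel) =
      ennreal (\<Lambda> ^ k / fact k * exp (- \<Lambda>)) * ennreal (1 / (g * Suc k + 1))"
      by (simp only: nn_integral_power_one_minus_powr[OF g])
  qed
  also have "\<dots> = (\<integral>\<^sup>+k. ennreal (\<Lambda> ^ k / fact k * exp (- \<Lambda>)) * ennreal (1 / (g * Suc k + 1)) \<partial>count_space UNIV)"
    by (rule nn_integral_count_space_nat[symmetric])
  also have "\<dots> = (\<integral>\<^sup>+k. ennreal (1 / (g * Suc k + 1)) \<partial>measure_pmf (poisson_pmf \<Lambda>))"
    by (simp only: nn_integral_measure_pmf pmf_poisson[OF \<Lambda>])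
  also have "enn2real \<dots> = measure_pmf.expectation (poisson_pmf \<Lambda>) (\<lambda>k. 1 / (g * Suc k + 1))"
    using g by (intro integral_eq_nn_integral[symmetric] AE_I2) auto
  finally show ?thesis .
qed

text \<open>This is the variance of P_j(A) divided by p(1-p). With g+1 kept inside the expectation,
  the averaged ratio stays in [0,1] for all g > 0 and has a positive limit at both ends.\<close>

definition variance_factor :: "real \<Rightarrow> real \<Rightarrow> real" where
  "variance_factor \<Lambda> g = measure_pmf.expectation (poisson_pmf \<Lambda>) (\<lambda>k. (g + 1) / (g * Suc k + 1))"

lemma variance_factor_eq:
  "\<Lambda> > 0 \<Longrightarrow> g > 0 \<Longrightarrow> variance_factor \<Lambda> g = (g + 1) * fdp_I g \<Lambda>"
  by (simp add: variance_factor_def fdp_I_eq_expectation flip: integral_mult_right_zero)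

lemma integrable_pmf_bounded:
  fixes f :: "'a \<Rightarrow> real"
  assumes "\<And>x. 0 \<le> f x" "\<And>x. f x \<le> 1"
  shows "integrable (measure_pmf p) f"
  using assms by (intro measure_pmf.integrable_const_bound[where B = 1]) auto

lemma variance_ratio_bounds:
  fixes g :: real
  assumes "g > 0"
  shows "0 \<le> (g + 1) / (g * real (Suc k) + 1)" "(g + 1) / (g * real (Suc k) + 1) \<le> 1"
proof -
  have "g * real (Suc k) \<ge> g" using assms by simp
  then show "0 \<le> (g + 1) / (g * real (Suc k) + 1)" "(g + 1) / (g * real (Suc k) + 1) \<le> 1"
    using assms by (simp_all only: divide_le_eq_1 zero_le_divide_iff) linarith+
qed

lemma integrable_variance_ratio:
  "g > 0 \<Longrightarrow> integrable (measure_pmf (poisson_pmf \<Lambda>)) (\<lambda>k. (g + 1) / (g * real (Suc k) + 1))"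
  by (intro integrable_pmf_bounded variance_ratio_bounds)

text \<open>From (1-gk)(g(k+1)+1) = g+1 - g^2 k(k+1) the ratio is at least 1-gk. This bound is
  linear in k, so averaging it needs only the Poisson mean; the upper bound is 1.\<close>

lemma tendsto_variance_factor_0:
  assumes \<Lambda>: "\<Lambda> > 0"
  shows "(variance_factor \<Lambda> \<longlongrightarrow> 1) (at_right 0)"
proof (rule real_tendsto_sandwich)
  show "((\<lambda>g. 1 - g * \<Lambda>) \<longlongrightarrow> 1) (at_right 0)"
    by (auto intro!: tendsto_eq_intros)
  show "\<forall>\<^sub>F g in at_right 0. 1 - g * \<Lambda> \<le> variance_factor \<Lambda> g"
  proof (intro eventually_at_right_less[THEN eventually_mono])
    fix g :: real assume g: "0 < g"
    have "1 - g * \<Lambda> = measure_pmf.expectation (poisson_pmf \<Lambda>) (\<lambda>k. 1 - g * real k)"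
      using poisson_expectation[OF \<Lambda>] by (subst Bochner_Integration.integral_diff) simp_all
    also have "\<dots> \<le> variance_factor \<Lambda> g"
      unfolding variance_factor_def
    proof (intro integral_mono integrable_variance_ratio g)
      show "integrable (measure_pmf (poisson_pmf \<Lambda>)) (\<lambda>k. 1 - g * real k)"
        using poisson_expectation(1)[OF \<Lambda>] by simp
      fix k :: nat
      have pos: "g * real (Suc k) + 1 > 0" using g by (intro add_nonneg_pos) auto
      have "(1 - g * real k) * (g * real (Suc k) + 1) = g + 1 - g * real k * (g * real (Suc k))"
        by (simp add: algebra_simps)
      also have "\<dots> \<le> g + 1" using g by simp
      finally show "1 - g * real k \<le> (g + 1) / (g * real (Suc k) + 1)"
        using pos by (simp only: pos_le_divide_eq)
    qed
    finally show "1 - g * \<Lambda> \<le> variance_factor \<Lambda> g" .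
  qed
  show "\<forall>\<^sub>F g in at_right 0. variance_factor \<Lambda> g \<le> 1"
  proof (intro eventually_at_right_less[THEN eventually_mono])
    fix g :: real assume g: "0 < g"
    show "variance_factor \<Lambda> g \<le> 1"
      unfolding variance_factor_def
      by (intro measure_pmf.integral_le_const integrable_variance_ratio variance_ratio_bounds g AE_I2)
  qed
qed simp

text \<open>The ratio lies between 1/(k+1) and 1/(k+1) + 1/g: below because k+1 \<ge> 1, above by
  dropping the 1 in the denominator. The error 1/g is uniform in k, so it survives averaging
  unchanged.\<close>

lemma tendsto_variance_factor_top:
  assumes \<Lambda>: "\<Lambda> > 0"
  shows "(variance_factor \<Lambda> \<longlongrightarrow> (1 - exp (- \<Lambda>)) / \<Lambda>) at_top"
proof (rule real_tendsto_sandwich)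
  let ?c = "(1 - exp (- \<Lambda>)) / \<Lambda>"
  have inv: "integrable (measure_pmf (poisson_pmf \<Lambda>)) (\<lambda>k. 1 / real (Suc k))"
    by (rule integrable_pmf_bounded) auto
  show "((\<lambda>g. ?c) \<longlongrightarrow> ?c) at_top" by simp
  have "((\<lambda>g. ?c + 1 / g) \<longlongrightarrow> ?c + 0) at_top"
    by (intro tendsto_add tendsto_const tendsto_divide_0[OF tendsto_const] filterlim_at_top_imp_at_infinity filterlim_ident)
  then show "((\<lambda>g. ?c + 1 / g) \<longlongrightarrow> ?c) at_top" by simp
  show "\<forall>\<^sub>F g in at_top. ?c \<le> variance_factor \<Lambda> g"
  proof (intro eventually_gt_at_top[of 0, THEN eventually_mono])
    fix g :: real assume g: "0 < g"
    have "?c = measure_pmf.expectation (poisson_pmf \<Lambda>) (\<lambda>k. 1 / real (Suc k))"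
      by (rule poisson_expectation_inverse_Suc[OF \<Lambda>, symmetric])
    also have "\<dots> \<le> variance_factor \<Lambda> g"
      unfolding variance_factor_def
    proof (intro integral_mono inv integrable_variance_ratio g)
      fix k :: nat
      have "g * real (Suc k) + 1 > 0" using g by (intro add_nonneg_pos) auto
      then show "1 / real (Suc k) \<le> (g + 1) / (g * real (Suc k) + 1)"
        using g by (simp add: divide_simps) (simp add: algebra_simps)
    qed
    finally show "?c \<le> variance_factor \<Lambda> g" .
  qed
  show "\<forall>\<^sub>F g in at_top. variance_factor \<Lambda> g \<le> ?c + 1 / g"
  proof (intro eventually_gt_at_top[of 0, THEN eventually_mono])
    fix g :: real assume g: "0 < g"
    have "variance_factor \<Lambda> g \<le> measure_pmf.expectation (poisson_pmf \<Lambda>) (\<lambda>k. 1 / real (Suc k) + 1 / g)"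
      unfolding variance_factor_def
    proof (intro integral_mono integrable_variance_ratio g Bochner_Integration.integrable_add inv)
      fix k :: nat
      have "g * real (Suc k) > 0" using g by (intro mult_pos_pos) auto
      then have "(g + 1) / (g * real (Suc k) + 1) \<le> (g + 1) / (g * real (Suc k))"
        using g by (intro divide_left_mono mult_pos_pos) linarith+
      also have "\<dots> = 1 / real (Suc k) + 1 / g * (1 / real (Suc k))"
        using g by (simp add: add_divide_distrib del: of_nat_Suc)
      also have "\<dots> \<le> 1 / real (Suc k) + 1 / g * 1"
        using g by (intro add_left_mono mult_left_mono) auto
      finally show "(g + 1) / (g * real (Suc k) + 1) \<le> 1 / real (Suc k) + 1 / g" by simp
    qed simp
    also have "\<dots> = ?c + 1 / g"
      using inv by (subst Bochner_Integration.integral_add) (simp_all only: poisson_expectation_inverse_Suc[OF \<Lambda>], simp_all)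
    finally show "variance_factor \<Lambda> g \<le> ?c + 1 / g" .
  qed
qed

section \<open>The correlation\<close>

lemma vec_fdp_cong:
  assumes "\<And>i. i \<in> {1..d} \<Longrightarrow> \<gamma> i = \<gamma>' i"
  shows "vec_fdp d \<Lambda> \<gamma> P\<^sub>0 = vec_fdp d \<Lambda> \<gamma>' P\<^sub>0"
proof -
  have "atoms_and_weights d \<gamma> P\<^sub>0 n = atoms_and_weights d \<gamma>' P\<^sub>0 n" for n
    unfolding atoms_and_weights_def using assms by (intro arg_cong2[where f = pair_measure] refl PiM_cong) auto
  then show ?thesis
    by (simp add: vec_fdp_def vec_fdp_given_def)
qed

lemma sets_vec_fdp:
  assumes "prob_space P\<^sub>0" "\<And>i. i \<in> {1..d} \<Longrightarrow> \<gamma> i > 0"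
  shows "sets (vec_fdp d \<Lambda> \<gamma> P\<^sub>0) = sets (prob_tuples d P\<^sub>0)" "prob_space (vec_fdp d \<Lambda> \<gamma> P\<^sub>0)"
  using vec_fdp_in_prob_algebra[OF assms] by (auto simp: space_prob_algebra)

lemma integral_vec_fdp:
  fixes f :: "(nat \<Rightarrow> 'a measure) \<Rightarrow> real"
  assumes P0: "prob_space P\<^sub>0" and \<gamma>: "\<And>i. i \<in> {1..d} \<Longrightarrow> \<gamma> i > 0"
    and f: "f \<in> borel_measurable (prob_tuples d P\<^sub>0)"
    and bnd: "\<And>p. p \<in> space (prob_tuples d P\<^sub>0) \<Longrightarrow> \<bar>f p\<bar> \<le> C"
  shows "(\<integral>p. f p \<partial>vec_fdp d \<Lambda> \<gamma> P\<^sub>0) =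
    measure_pmf.expectation (poisson_pmf \<Lambda>) (\<lambda>k. \<integral>p. f p \<partial>vec_fdp_given d \<gamma> P\<^sub>0 (Suc k))"
  unfolding vec_fdp_def
proof (rule integral_bind_bounded[OF measure_pmf.prob_space_axioms _ f bnd])
  show "(\<lambda>k. vec_fdp_given d \<gamma> P\<^sub>0 (Suc k)) \<in> measure_pmf (poisson_pmf \<Lambda>) \<rightarrow>\<^sub>M prob_algebra (prob_tuples d P\<^sub>0)"
    using vec_fdp_given_in_prob_algebra[OF P0 \<gamma>] by (auto simp: measurable_def)
qed

text \<open>The mixture over M adds no between-group term, since the conditional mean does not
  depend on M.\<close>

lemma covariance_vec_fdp:
  assumes P0: "prob_space P\<^sub>0" and \<gamma>: "\<forall>i\<in>{1..d}. \<gamma> i > 0" and \<Lambda>: "\<Lambda> > 0"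
    and A: "A \<in> sets P\<^sub>0" and j: "j \<in> {1..d}" and l: "l \<in> {1..d}"
  shows "covariance (vec_fdp d \<Lambda> \<gamma> P\<^sub>0) (\<lambda>p. measure (p j) A) (\<lambda>p. measure (p l) A) =
    measure P\<^sub>0 A * (1 - measure P\<^sub>0 A) *
      (if j = l then variance_factor \<Lambda> (\<gamma> j) else (1 - exp (- \<Lambda>)) / \<Lambda>)"
proof -
  \<comment> \<open>The conditional results ask for positive shapes at every index, while
    \<open>\<gamma>\<close> is constrained only on \<open>{1..d}\<close>. Setting it to 1 elsewhere
    leaves the law unchanged.\<close>
  define \<gamma>' where "\<gamma>' = (\<lambda>i. if i \<in> {1..d} then \<gamma> i else 1)"
  have \<gamma>': "\<gamma>' i > 0" for i using \<gamma> by (simp add: \<gamma>'_def)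
  have eq: "vec_fdp d \<Lambda> \<gamma> P\<^sub>0 = vec_fdp d \<Lambda> \<gamma>' P\<^sub>0"
    by (rule vec_fdp_cong) (simp add: \<gamma>'_def)
  let ?V = "vec_fdp d \<Lambda> \<gamma>' P\<^sub>0" and ?p = "measure P\<^sub>0 A"
  interpret V: prob_space ?V by (rule sets_vec_fdp(2)[OF P0 \<gamma>'])
  have sets: "sets ?V = sets (prob_tuples d P\<^sub>0)" by (rule sets_vec_fdp(1)[OF P0 \<gamma>'])
  have p: "0 \<le> ?p" "?p \<le> 1" using prob_space.prob_le_1[OF P0] by auto
  note meas [measurable] = measurable_evaluation[OF A]
  have bnd: "\<bar>measure (q i) A - ?p\<bar> \<le> 1" if "q \<in> space (prob_tuples d P\<^sub>0)" "i \<in> {1..d}" for q i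
    using evaluation_bounds[OF that, of A] p by linarith
  \<comment> \<open>\<open>covariance\<close> centres at the mean under the mixture and the
    conditional results centre at \<open>?p\<close>; the two must be identified first.\<close>
  have mean: "(\<integral>q. measure (q i) A \<partial>?V) = ?p" if i: "i \<in> {1..d}" for i
  proof -
    have int: "integrable ?V (\<lambda>q. measure (q i) A)"
    proof (rule V.integrable_const_bound[where B = 1])
      show "AE q in ?V. norm (measure (q i) A) \<le> 1"
        using evaluation_bounds[OF _ i] sets_eq_imp_space_eq[OF sets] by (intro AE_I2) auto
      show "(\<lambda>q. measure (q i) A) \<in> borel_measurable ?V"
        using meas[OF i] by (simp cong: measurable_cong_sets add: sets)
    qed
    have "(\<integral>q. measure (q i) A - ?p \<partial>?V) =
      measure_pmf.expectation (poisson_pmf \<Lambda>) (\<lambda>k. \<integral>q. measure (q i) A - ?p \<partial>vec_fdp_given d \<gamma>' P\<^sub>0 (Suc k))"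
      using meas[OF i] bnd[OF _ i] by (intro integral_vec_fdp[OF P0 \<gamma>', where C = 1]) auto
    also have "\<dots> = 0"
      by (simp add: vec_fdp_given_mean[OF \<gamma>' P0 A _ i])
    finally show ?thesis
      using int by (simp add: V.prob_space)
  qed
  have "covariance ?V (\<lambda>q. measure (q j) A) (\<lambda>q. measure (q l) A) =
    (\<integral>q. (measure (q j) A - ?p) * (measure (q l) A - ?p) \<partial>?V)"
    unfolding covariance_def by (simp only: mean[OF j] mean[OF l])
  also have "\<dots> = measure_pmf.expectation (poisson_pmf \<Lambda>) (\<lambda>k. \<integral>q. (measure (q j) A - ?p) * (measure (q l) A - ?p) \<partial>vec_fdp_given d \<gamma>' P\<^sub>0 (Suc k))"
    using meas[OF j] meas[OF l] bnd[OF _ j] bnd[OF _ l]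
    by (intro integral_vec_fdp[OF P0 \<gamma>', where C = 1]) (auto simp: abs_mult intro!: mult_le_one)
  also have "\<dots> = measure_pmf.expectation (poisson_pmf \<Lambda>)
      (\<lambda>k. ?p * (1 - ?p) * (if j = l then (\<gamma> j + 1) / (\<gamma> j * Suc k + 1) else 1 / Suc k))"
    using j by (intro Bochner_Integration.integral_cong refl, subst vec_fdp_given_covariance[OF \<gamma>' P0 A _ j l])
      (auto simp: \<gamma>'_def mult.commute)
  also have "\<dots> = ?p * (1 - ?p) * (if j = l then variance_factor \<Lambda> (\<gamma> j) else (1 - exp (- \<Lambda>)) / \<Lambda>)"
    using poisson_expectation_inverse_Suc[OF \<Lambda>] by (cases "j = l") (simp_all only: integral_mult_right_zero variance_factor_def if_True if_False simp_thms)
  finally show ?thesis unfolding eq .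
qed

text \<open>The factor p(1-p) occurs once in the numerator and squared under the root. It is
  positive because 0 < p < 1, and therefore cancels.\<close>

lemma corr_vec_fdp:
  assumes P0: "prob_space P\<^sub>0" and \<gamma>: "\<forall>i\<in>{1..d}. \<gamma> i > 0" and \<Lambda>: "\<Lambda> > 0"
    and A: "A \<in> sets P\<^sub>0" "0 < measure P\<^sub>0 A" "measure P\<^sub>0 A < 1"
    and jl: "j \<in> {1..d}" "l \<in> {1..d}" "j \<noteq> l"
  shows "corr (vec_fdp d \<Lambda> \<gamma> P\<^sub>0) (\<lambda>p. measure (p j) A) (\<lambda>p. measure (p l) A) =
    (1 - exp (- \<Lambda>)) / \<Lambda> / sqrt (variance_factor \<Lambda> (\<gamma> j) * variance_factor \<Lambda> (\<gamma> l))"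
proof -
  let ?q = "measure P\<^sub>0 A * (1 - measure P\<^sub>0 A)"
  have q: "?q > 0" using A by simp
  have "sqrt (?q * variance_factor \<Lambda> (\<gamma> j) * (?q * variance_factor \<Lambda> (\<gamma> l))) =
    sqrt (?q\<^sup>2 * (variance_factor \<Lambda> (\<gamma> j) * variance_factor \<Lambda> (\<gamma> l)))"
    by (simp add: power2_eq_square mult_ac)
  also have "\<dots> = ?q * sqrt (variance_factor \<Lambda> (\<gamma> j) * variance_factor \<Lambda> (\<gamma> l))"
    using q by (simp only: real_sqrt_mult real_sqrt_abs abs_of_pos)
  finally have s: "sqrt (?q * variance_factor \<Lambda> (\<gamma> j) * (?q * variance_factor \<Lambda> (\<gamma> l))) =
    ?q * sqrt (variance_factor \<Lambda> (\<gamma> j) * variance_factor \<Lambda> (\<gamma> l))" .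
  have "corr (vec_fdp d \<Lambda> \<gamma> P\<^sub>0) (\<lambda>p. measure (p j) A) (\<lambda>p. measure (p l) A) =
    ?q * ((1 - exp (- \<Lambda>)) / \<Lambda>) / (?q * sqrt (variance_factor \<Lambda> (\<gamma> j) * variance_factor \<Lambda> (\<gamma> l)))"
    unfolding corr_def covariance_vec_fdp[OF P0 \<gamma> \<Lambda> A(1) jl(1,2)] covariance_vec_fdp[OF P0 \<gamma> \<Lambda> A(1) jl(1,1)]
      covariance_vec_fdp[OF P0 \<gamma> \<Lambda> A(1) jl(2,2)]
    using jl(3) by (simp only: s if_True if_False refl)
  also have "\<dots> = (1 - exp (- \<Lambda>)) / \<Lambda> / sqrt (variance_factor \<Lambda> (\<gamma> j) * variance_factor \<Lambda> (\<gamma> l))"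
    using q by (simp only: mult_divide_mult_cancel_left less_imp_neq[symmetric] not_False_eq_True)
  finally show ?thesis .
qed

text \<open>Correlation depends only on the joint law, so a statement about random measures on an
  arbitrary probability space can be computed on the space of tuples.\<close>

lemma corr_distr:
  assumes X: "X \<in> M \<rightarrow>\<^sub>M N" and f: "f \<in> borel_measurable N" and g: "g \<in> borel_measurable N"
  shows "corr (distr M N X) f g = corr M (\<lambda>x. f (X x)) (\<lambda>x. g (X x))"
proof -
  have "covariance (distr M N X) f g = covariance M (\<lambda>x. f (X x)) (\<lambda>x. g (X x))"
    if [measurable]: "f \<in> borel_measurable N" "g \<in> borel_measurable N" for f g
    unfolding covariance_def integral_distr[OF X that(1)] integral_distr[OF X that(2)]
    by (rule integral_distr[OF X]) measurable
  with f g show ?thesis by (simp add: corr_def)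
qed

text \<open>One statement serves both limits: \<open>at_right 0\<close> with c = 1, and
  \<open>at_top\<close> with c equal to the numerator. Both variables run through the same filter,
  so the root tends to sqrt(c c) = c.\<close>

lemma tendsto_corr_vec_fdp:
  assumes P0: "prob_space P\<^sub>0" and \<gamma>: "\<forall>i\<in>{1..d}. \<gamma> i > 0" and \<Lambda>: "\<Lambda> > 0"
    and A: "A \<in> sets P\<^sub>0" "0 < measure P\<^sub>0 A" "measure P\<^sub>0 A < 1"
    and jl: "j \<in> {1..d}" "l \<in> {1..d}" "j \<noteq> l"
    and F: "\<forall>\<^sub>F g in F. g > 0" and lim: "(variance_factor \<Lambda> \<longlongrightarrow> c) F" and c: "c > 0"
  shows "((\<lambda>(a, b). corr (vec_fdp d \<Lambda> (\<gamma>(j := a, l := b)) P\<^sub>0) (\<lambda>p. measure (p j) A) (\<lambda>p. measure (p l) A))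
    \<longlongrightarrow> (1 - exp (- \<Lambda>)) / \<Lambda> / c) (F \<times>\<^sub>F F)"
proof -
  let ?v = "variance_factor \<Lambda>"
  have "((\<lambda>x. (1 - exp (- \<Lambda>)) / \<Lambda> / sqrt (?v (fst x) * ?v (snd x))) \<longlongrightarrow> (1 - exp (- \<Lambda>)) / \<Lambda> / sqrt (c * c)) (F \<times>\<^sub>F F)"
    using c by (intro tendsto_divide tendsto_const tendsto_real_sqrt tendsto_mult
        filterlim_compose[OF lim filterlim_fst] filterlim_compose[OF lim filterlim_snd]) simp
  \<comment> \<open>The closed formula holds only for positive shapes, which is why equality is
    claimed eventually. As \<open>j \<noteq> l\<close>, the second update does not overwrite the
    first.\<close>
  moreover have "\<forall>\<^sub>F x in F \<times>\<^sub>F F. (1 - exp (- \<Lambda>)) / \<Lambda> / sqrt (?v (fst x) * ?v (snd x)) =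
    (case x of (a, b) \<Rightarrow> corr (vec_fdp d \<Lambda> (\<gamma>(j := a, l := b)) P\<^sub>0) (\<lambda>p. measure (p j) A) (\<lambda>p. measure (p l) A))"
    using eventually_prodI[OF F F]
  proof eventually_elim
    case (elim x)
    obtain a b where x: "x = (a, b)" by (cases x)
    with elim have ab: "a > 0" "b > 0" by simp_all
    have pos: "\<forall>i\<in>{1..d}. (\<gamma>(j := a, l := b)) i > 0"
      using ab \<gamma> by simp
    have "corr (vec_fdp d \<Lambda> (\<gamma>(j := a, l := b)) P\<^sub>0) (\<lambda>p. measure (p j) A) (\<lambda>p. measure (p l) A) =
      (1 - exp (- \<Lambda>)) / \<Lambda> / sqrt (?v a * ?v b)"
      using jl(3) by (subst corr_vec_fdp[OF P0 pos \<Lambda> A jl]) simp_all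
    then show ?case by (simp only: x fst_conv snd_conv prod.case)
  qed
  ultimately show ?thesis
    using c by (subst (asm) tendsto_cong) (simp_all add: real_sqrt_mult_self)
qed

theorem mainTheorem7:
  fixes \<Theta> :: "(real ^ 's) set" and P\<^sub>0 :: "(real ^ 's) measure"
    and d :: nat and \<Lambda> :: real and \<gamma> :: "nat \<Rightarrow> real"
    and \<Omega> :: "'w measure" and P :: "nat \<Rightarrow> 'w \<Rightarrow> (real ^ 's) measure"
    and A :: "(real ^ 's) set" and j l :: nat
  assumes P0_prob: "prob_space P\<^sub>0"
    and P0_sets: "sets P\<^sub>0 = sets (restrict_space borel \<Theta>)"
    and P0_diffuse: "\<forall>x\<in>\<Theta>. emeasure P\<^sub>0 {x} = 0"
    and \<Lambda>_pos: "\<Lambda> > 0"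
    and \<gamma>_pos: "\<forall>i\<in>{1..d}. \<gamma> i > 0"
    and \<Omega>_prob: "prob_space \<Omega>"
    and P_measurable: "(\<lambda>\<omega>. \<lambda>i\<in>{1..d}. P i \<omega>) \<in> \<Omega> \<rightarrow>\<^sub>M prob_tuples d P\<^sub>0"
    and P_law: "distr \<Omega> (prob_tuples d P\<^sub>0) (\<lambda>\<omega>. \<lambda>i\<in>{1..d}. P i \<omega>) = vec_fdp d \<Lambda> \<gamma> P\<^sub>0"
    and A_meas: "A \<in> sets P\<^sub>0"
    and A_nontrivial: "0 < measure P\<^sub>0 A" "measure P\<^sub>0 A < 1"
    and jl: "j \<in> {1..d}" "l \<in> {1..d}" "j \<noteq> l"
  shows "corr \<Omega> (\<lambda>\<omega>. measure (P j \<omega>) A) (\<lambda>\<omega>. measure (P l \<omega>) A) =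
        (1 - exp (- \<Lambda>)) /
        (\<Lambda> * sqrt ((\<gamma> j + 1) * (\<gamma> l + 1) * fdp_I (\<gamma> j) \<Lambda> * fdp_I (\<gamma> l) \<Lambda>))
    \<and> ((\<lambda>(a, b). corr (vec_fdp d \<Lambda> (\<gamma>(j := a, l := b)) P\<^sub>0)
            (\<lambda>p. measure (p j) A) (\<lambda>p. measure (p l) A))
        \<longlongrightarrow> (1 - exp (- \<Lambda>)) / \<Lambda>) (at_right 0 \<times>\<^sub>F at_right 0)
    \<and> ((\<lambda>(a, b). corr (vec_fdp d \<Lambda> (\<gamma>(j := a, l := b)) P\<^sub>0)
            (\<lambda>p. measure (p j) A) (\<lambda>p. measure (p l) A))
        \<longlongrightarrow> 1) (at_top \<times>\<^sub>F at_top)"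
proof (intro conjI)
  note limit = tendsto_corr_vec_fdp[OF P0_prob \<gamma>_pos \<Lambda>_pos A_meas A_nontrivial jl]
  have "corr \<Omega> (\<lambda>\<omega>. measure (P j \<omega>) A) (\<lambda>\<omega>. measure (P l \<omega>) A) =
      corr (vec_fdp d \<Lambda> \<gamma> P\<^sub>0) (\<lambda>p. measure (p j) A) (\<lambda>p. measure (p l) A)"
    unfolding P_law[symmetric]
    using jl by (subst corr_distr[OF P_measurable measurable_evaluation[OF A_meas jl(1)] measurable_evaluation[OF A_meas jl(2)]]) simp
  also have "\<dots> = (1 - exp (- \<Lambda>)) / \<Lambda> / sqrt (variance_factor \<Lambda> (\<gamma> j) * variance_factor \<Lambda> (\<gamma> l))"
    by (rule corr_vec_fdp[OF P0_prob \<gamma>_pos \<Lambda>_pos A_meas A_nontrivial jl])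
  also have "variance_factor \<Lambda> (\<gamma> j) * variance_factor \<Lambda> (\<gamma> l) =
      (\<gamma> j + 1) * (\<gamma> l + 1) * fdp_I (\<gamma> j) \<Lambda> * fdp_I (\<gamma> l) \<Lambda>"
    using \<gamma>_pos jl by (simp add: variance_factor_eq[OF \<Lambda>_pos] mult_ac)
  finally show "corr \<Omega> (\<lambda>\<omega>. measure (P j \<omega>) A) (\<lambda>\<omega>. measure (P l \<omega>) A) =
        (1 - exp (- \<Lambda>)) /
        (\<Lambda> * sqrt ((\<gamma> j + 1) * (\<gamma> l + 1) * fdp_I (\<gamma> j) \<Lambda> * fdp_I (\<gamma> l) \<Lambda>))"
    by (simp only: divide_divide_eq_left)
  show "((\<lambda>(a, b). corr (vec_fdp d \<Lambda> (\<gamma>(j := a, l := b)) P\<^sub>0)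
            (\<lambda>p. measure (p j) A) (\<lambda>p. measure (p l) A))
        \<longlongrightarrow> (1 - exp (- \<Lambda>)) / \<Lambda>) (at_right 0 \<times>\<^sub>F at_right 0)"
    using limit[OF eventually_at_right_less tendsto_variance_factor_0[OF \<Lambda>_pos]] by simp
  \<comment> \<open>Here the limit of the variance factor coincides with the numerator, so the
    quotient is 1 once it is known to be nonzero.\<close>
  have c: "(1 - exp (- \<Lambda>)) / \<Lambda> > 0"
    using \<Lambda>_pos by simp
  show "((\<lambda>(a, b). corr (vec_fdp d \<Lambda> (\<gamma>(j := a, l := b)) P\<^sub>0)
            (\<lambda>p. measure (p j) A) (\<lambda>p. measure (p l) A))
        \<longlongrightarrow> 1) (at_top \<times>\<^sub>F at_top)"
    using limit[OF eventually_gt_at_top tendsto_variance_factor_top[OF \<Lambda>_pos] c] c \<Lambda>_pos by simp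
qed

end
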